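(* (a) Let $G$ be a maximal outerplanar graph of order $n\ge 3$. If $I$ is a nondecreasing distance-based topological index, then $I(G)\le I(P_n^2)$; if $I$ is a nonincreasing distance-based topological index, then $I(G)\ge I(P_n^2)$. (b) Let $G$ be an Apollonian network of order $n\ge 3$. If $I$ is a nondecreasing distance-based topological index, then $I(G)\le I(P_n^3)$; if $I$ is a nonincreasing distance-based topological index, then $I(G)\ge I(P_n^3)$.
   Context: All graphs are finite and simple. The order of a graph is its number of vertices. A graph is outerplanar if it can be embedded in the plane such that no two edges intersect and every vertex is on the boundary of the outer face; it is maximal outerplanar if it is outerplanar but after adding any edge it no longer has this property. Apollonian networks (planar $3$-trees) are the planar graphs obtained from a triangle by successively (zero or more times) inserting a new vertex into a face of length three and joining the new vertex to the three vertices on this face by edges. $P_n$ is the path on $n$ vertices. The $k$-th power $G^k$ of a graph $G$ is the graph on the same vertex set in which two distinct vertices are adjacent if their distance in $G$ is at most $k$. For a connected graph $G$, $d_G(u,v)$ is the usual shortest-path distance. The distance sequence $\mathcal{D}(G)$ of a connected graph $G$ is the nondecreasing sequence (of length $\binom{n}{2}$ if $G$ has order $n$) of the distances between all unordered pairs of distinct vertices of $G$, with repetitions. A topological index $I$, assigning a real number to each connected graph, is distance-based if it can be expressed in the form $I(G)=g(\mathcal{D}(G))$, where $g$ is a real-valued function defined on the set of all finite sequences of positive integers. It is called nondecreasing (nonincreasing) if $g$, when restricted to sequences of any fixed length, is nondecreasing (nonincreasing) in every coordinate. *)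

theory Defs
  imports
    "HOL-Analysis.Analysis"
    "HOL-Library.Extended_Nat"
    "HOL-Library.Multiset"
    "Graph_Theory.Pair_Digraph"
    "Graph_Theory.Digraph_Component"
begin

text \<open>
  A finite simple graph is a \<^locale>\<open>pair_graph\<close>: a finite, symmetric, loop-free digraph
  without parallel arcs. An undirected edge \<open>{u, v}\<close> is the pair of arcs \<open>(u, v)\<close>, \<open>(v, u)\<close>.
\<close>

hide_const (open) Digraph_Component.connected

definition edges :: "'a pair_pre_digraph \<Rightarrow> 'a set set" where
  "edges G = {{u, v} |u v. (u, v) \<in> parcs G}"

definition connected_graph :: "'a pair_pre_digraph \<Rightarrow> bool" where
  "connected_graph G \<longleftrightarrow> pair_graph G \<and> Digraph_Component.connected (with_proj G)"

definition add_edge :: "'a \<Rightarrow> 'a \<Rightarrow> 'a pair_pre_digraph \<Rightarrow> 'a pair_pre_digraph" where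
  "add_edge u v G = \<lparr>pverts = pverts G, parcs = parcs G \<union> {(u, v), (v, u)}\<rparr>"

definition add_joined_vertex :: "'a \<Rightarrow> 'a set \<Rightarrow> 'a pair_pre_digraph \<Rightarrow> 'a pair_pre_digraph" where
  "add_joined_vertex w S G =
     \<lparr>pverts = insert w (pverts G), parcs = parcs G \<union> {w} \<times> S \<union> S \<times> {w}\<rparr>"

text \<open>The distance is \<open>\<infinity>\<close> between vertices that are not joined by a walk.\<close>

definition graph_dist :: "'a pair_pre_digraph \<Rightarrow> 'a \<Rightarrow> 'a \<Rightarrow> enat" where
  "graph_dist G u v = (INF p\<in>{p. pre_digraph.awalk (with_proj G) u p v}. enat (length p))"

definition graph_power :: "'a pair_pre_digraph \<Rightarrow> nat \<Rightarrow> 'a pair_pre_digraph" where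
  "graph_power G k =
     \<lparr>pverts = pverts G,
      parcs = {(u, v). u \<in> pverts G \<and> v \<in> pverts G \<and> u \<noteq> v \<and> graph_dist G u v \<le> enat k}\<rparr>"

text \<open>
  \<open>is_path_graph n P\<close>: \<open>P\<close> is a copy of the path on \<open>n\<close> vertices. Any vertices of type \<open>'a\<close>
  may serve, so that a topological index on the graphs over \<open>'a\<close> can be applied to its powers.
\<close>

definition is_path_graph :: "nat \<Rightarrow> 'a pair_pre_digraph \<Rightarrow> bool" where
  "is_path_graph n P \<longleftrightarrow>
     (\<exists>p. distinct p \<and> length p = n \<and>
          P = \<lparr>pverts = set p,
               parcs = {(p ! i, p ! j) |i j. i < n \<and> j < n \<and> (j = Suc i \<or> i = Suc j)}\<rparr>)"

definition triangle_graph :: "'a \<Rightarrow> 'a \<Rightarrow> 'a \<Rightarrow> 'a pair_pre_digraph" where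
  "triangle_graph a b c =
     \<lparr>pverts = {a, b, c}, parcs = {(a, b), (b, a), (b, c), (c, b), (a, c), (c, a)}\<rparr>"


subsection \<open>Plane embeddings\<close>

text \<open>
  Vertices become points (\<open>\<phi>\<close>), edges become the point sets of simple arcs (\<open>\<gamma>\<close>) that
  meet vertices and other edges only in common end points.
\<close>

definition plane_embedding ::
    "'a pair_pre_digraph \<Rightarrow> ('a \<Rightarrow> complex) \<Rightarrow> ('a set \<Rightarrow> complex set) \<Rightarrow> bool" where
  "plane_embedding G \<phi> \<gamma> \<longleftrightarrow>
     inj_on \<phi> (pverts G) \<and>
     (\<forall>(u, v)\<in>parcs G. \<exists>g. arc g \<and> pathstart g = \<phi> u \<and> pathfinish g = \<phi> v \<and>
        path_image g = \<gamma> {u, v} \<and> path_image g \<inter> \<phi> ` pverts G = {\<phi> u, \<phi> v}) \<and>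
     (\<forall>e\<in>edges G. \<forall>f\<in>edges G. e \<noteq> f \<longrightarrow> \<gamma> e \<inter> \<gamma> f = \<phi> ` (e \<inter> f))"

definition drawing ::
    "'a pair_pre_digraph \<Rightarrow> ('a \<Rightarrow> complex) \<Rightarrow> ('a set \<Rightarrow> complex set) \<Rightarrow> complex set" where
  "drawing G \<phi> \<gamma> = \<phi> ` pverts G \<union> \<Union> (\<gamma> ` edges G)"

text \<open>
  As the drawing of a finite graph is compact, \<^const>\<open>outside\<close> is the unique unbounded
  component of its complement, that is, the outer face.
\<close>

definition outerplanar :: "'a pair_pre_digraph \<Rightarrow> bool" where
  "outerplanar G \<longleftrightarrow>
     (\<exists>\<phi> \<gamma>. plane_embedding G \<phi> \<gamma> \<and> \<phi> ` pverts G \<subseteq> frontier (outside (drawing G \<phi> \<gamma>)))"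

definition maximal_outerplanar :: "'a pair_pre_digraph \<Rightarrow> bool" where
  "maximal_outerplanar G \<longleftrightarrow>
     pair_graph G \<and> outerplanar G \<and>
     (\<forall>u\<in>pverts G. \<forall>v\<in>pverts G.
        u \<noteq> v \<and> (u, v) \<notin> parcs G \<longrightarrow> \<not> outerplanar (add_edge u v G))"

definition triangular_face ::
    "'a pair_pre_digraph \<Rightarrow> ('a \<Rightarrow> complex) \<Rightarrow> ('a set \<Rightarrow> complex set) \<Rightarrow>
     complex set \<Rightarrow> 'a \<Rightarrow> 'a \<Rightarrow> 'a \<Rightarrow> bool" where
  "triangular_face G \<phi> \<gamma> F x y z \<longleftrightarrow>
     F \<in> components (- drawing G \<phi> \<gamma>) \<and>
     (x, y) \<in> parcs G \<and> (y, z) \<in> parcs G \<and> (x, z) \<in> parcs G \<and>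
     frontier F = \<gamma> {x, y} \<union> \<gamma> {y, z} \<union> \<gamma> {x, z}"

text \<open>
  \<open>apollonian_plane G \<phi> \<gamma>\<close>: the plane graph \<open>G\<close>, embedded by \<open>\<phi>\<close> and \<open>\<gamma>\<close>, arises from a triangle
  by successive insertions into triangular faces (the outer face included). In the insertion
  step the new embedding extends the old one and puts the new vertex into the face \<open>F\<close>. The
  arcs of the new edges then lie in \<open>F\<close>, apart from their old end points, since they do not
  meet the old drawing elsewhere.
\<close>

inductive apollonian_plane ::
    "'a pair_pre_digraph \<Rightarrow> ('a \<Rightarrow> complex) \<Rightarrow> ('a set \<Rightarrow> complex set) \<Rightarrow> bool" where
  triangle:
    "apollonian_plane (triangle_graph a b c) \<phi> \<gamma>"
    if "a \<noteq> b" "b \<noteq> c" "a \<noteq> c" "plane_embedding (triangle_graph a b c) \<phi> \<gamma>"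
| insert:
    "apollonian_plane (add_joined_vertex w {x, y, z} G) \<phi>' \<gamma>'"
    if "apollonian_plane G \<phi> \<gamma>"
      and "triangular_face G \<phi> \<gamma> F x y z"
      and "w \<notin> pverts G"
      and "plane_embedding (add_joined_vertex w {x, y, z} G) \<phi>' \<gamma>'"
      and "\<forall>v\<in>pverts G. \<phi>' v = \<phi> v"
      and "\<forall>e\<in>edges G. \<gamma>' e = \<gamma> e"
      and "\<phi>' w \<in> F"

definition apollonian_network :: "'a pair_pre_digraph \<Rightarrow> bool" where
  "apollonian_network G \<longleftrightarrow> (\<exists>\<phi> \<gamma>. apollonian_plane G \<phi> \<gamma>)"


subsection \<open>Distance-based topological indices\<close>

text \<open>
  The sequence ranges over the unordered pairs \<open>e\<close> of distinct vertices. For a connected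
  graph all these distances are finite and \<^const>\<open>The\<close> is well defined by symmetry.
\<close>

definition distance_sequence :: "'a pair_pre_digraph \<Rightarrow> nat list" where
  "distance_sequence G =
     sorted_list_of_multiset
       (image_mset (\<lambda>e. THE d. \<exists>u v. e = {u, v} \<and> graph_dist G u v = enat d)
         (mset_set {e. e \<subseteq> pverts G \<and> card e = 2}))"

definition distance_based_via :: "(nat list \<Rightarrow> real) \<Rightarrow> ('a pair_pre_digraph \<Rightarrow> real) \<Rightarrow> bool" where
  "distance_based_via g I \<longleftrightarrow> (\<forall>G. connected_graph G \<longrightarrow> I G = g (distance_sequence G))"

text \<open>Only the values of \<open>g\<close> at sequences of positive integers matter.\<close>

definition coordinatewise_nondecreasing :: "(nat list \<Rightarrow> real) \<Rightarrow> bool" where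
  "coordinatewise_nondecreasing g \<longleftrightarrow>
     (\<forall>xs i b. (\<forall>x\<in>set xs. 0 < x) \<and> i < length xs \<and> xs ! i \<le> b \<longrightarrow> g xs \<le> g (xs[i := b]))"

definition coordinatewise_nonincreasing :: "(nat list \<Rightarrow> real) \<Rightarrow> bool" where
  "coordinatewise_nonincreasing g \<longleftrightarrow>
     (\<forall>xs i b. (\<forall>x\<in>set xs. 0 < x) \<and> i < length xs \<and> xs ! i \<le> b \<longrightarrow> g (xs[i := b]) \<le> g xs)"

definition nondecreasing_distance_based :: "('a pair_pre_digraph \<Rightarrow> real) \<Rightarrow> bool" where
  "nondecreasing_distance_based I \<longleftrightarrow>
     (\<exists>g. distance_based_via g I \<and> coordinatewise_nondecreasing g)"

definition nonincreasing_distance_based :: "('a pair_pre_digraph \<Rightarrow> real) \<Rightarrow> bool" where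
  "nonincreasing_distance_based I \<longleftrightarrow>
     (\<exists>g. distance_based_via g I \<and> coordinatewise_nonincreasing g)"

end

theory Submission
  imports Defs
begin

text \<open>
  Both classes consist of graphs built from the empty set by successively adding a vertex with
  \<open>k\<close> earlier neighbours (or all earlier vertices, if fewer), for \<open>k = 2\<close> and \<open>k = 3\<close>. Such a graph
  is \<open>k\<close>-connected, so every ball of radius \<open>d\<close> has at least \<open>min n (k d + 1)\<close> vertices. Applied to the
  last vertex at every stage this gives at least \<open>\<Sum>m<n. min m (k d)\<close> pairs at distance at most \<open>d\<close>,
  which is the number attained by the \<open>k\<close>-th power of the path; hence the sorted distance
  sequences compare coordinatewise.

  For Apollonian networks the construction is the definition. A maximal outerplanar graph is
  first shown to be a triangulated polygon. In a plane drawing of a theta graph one of the three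
  arcs lies inside the cycle formed by the other two (Janiszewski), hence not all three have inner
  vertices on the outer face, and a cycle has no two crossing chords. These two exclusions yield a
  linear order of the vertices in which no two edges cross; with the vertices placed on a parabola
  in this order, any further edge that crosses no other one could be added, so by maximality it is
  already present.
\<close>

section \<open>Theta curves in the plane\<close>

text \<open>A drawing gives no direct access to the order of the vertices along the outer face, and
  inserting an edge into an arbitrary topological drawing is awkward. The given drawing therefore
  serves only to exclude two configurations of paths; from there on the argument is about lists of
  vertices, and the only drawing that has to be produced is a straight-line one.

  Maximality cannot be used at the start: cut vertices and several components are ruled out only
  once a noncrossing order is at hand. Hence the order is constructed for every outerplanar graph,
  by gluing orders along cut vertices and by taking Hamiltonian cycles of the pieces that have none.

  Indices are compared by counting: two sorted sequences of equal length compare coordinatewise as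
  soon as, for every \<open>d\<close>, the entries that are at most \<open>d\<close> are no fewer in
  the sequence that is to be smaller. The counts of the single stages add up because distances
  measured in an earlier stage can only shrink when further vertices arrive.\<close>

lemma insideD: "x \<in> inside S \<Longrightarrow> x \<notin> S" "x \<in> inside S \<Longrightarrow> x \<notin> outside S"
  by (auto simp: inside_def outside_def)

lemma inside_Un_Int_empty:
  assumes "S - {a, b} \<subseteq> outside (T \<union> U)" "a \<in> T" "b \<in> T"
  shows "inside (T \<union> U) \<inter> (S \<union> T) = {}"
proof -
  have "x \<notin> S \<union> T" if "x \<in> inside (T \<union> U)" for x
    using insideD[OF that] assms by auto
  then show ?thesis by blast
qed

lemma outsideI: "x \<notin> S \<Longrightarrow> x \<notin> inside S \<Longrightarrow> x \<in> outside S"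
  by (auto simp: inside_def outside_def)

text \<open>The Jordan curve theorem for the closed curve that runs along \<open>g\<close> and back
  along \<open>h\<close>. The closedness of \<open>J \<union> inside J\<close> serves to trap a
  whole arc once its inner points are trapped.\<close>

lemma theta_Jordan:
  fixes g h :: "real \<Rightarrow> complex"
  assumes "arc g" "arc h" "pathstart g = a" "pathfinish g = b" "pathstart h = a" "pathfinish h = b"
    and "path_image g \<inter> path_image h = {a, b}"
  defines "J \<equiv> path_image g \<union> path_image h"
  shows "inside J \<noteq> {}" "open (inside J)" "connected (inside J)" "connected (outside J)"
    "frontier (inside J) = J" "compact J" "closed (J \<union> inside J)"
proof -
  let ?c = "g +++ reversepath h"
  have im: "path_image ?c = J"
    using assms by (simp add: path_image_join J_def)
  have "simple_path ?c"
    using assms by (intro simple_path_join_loop) (auto simp: arc_reversepath)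
  moreover have "pathfinish ?c = pathstart ?c"
    using assms by simp
  ultimately have J: "inside J \<noteq> {} \<and> open (inside J) \<and> connected (inside J) \<and> connected (outside J)
      \<and> frontier (inside J) = J"
    using Jordan_inside_outside[of ?c] unfolding im by blast
  then show "inside J \<noteq> {}" "open (inside J)" "connected (inside J)" "connected (outside J)"
    "frontier (inside J) = J" by blast+
  show "compact J"
    using assms by (simp add: compact_Un compact_arc_image J_def)
  show "closed (J \<union> inside J)"
    using closed_path_image_Un_inside[of ?c] \<open>simple_path ?c\<close> unfolding im
    by (simp add: simple_path_imp_path)
qed

lemma connected_disjoint_inside_or_outside:
  assumes "connected T" "T \<inter> S = {}"
  shows "T \<subseteq> inside S \<or> T \<subseteq> outside S"
  using assms inside_outside_intersect_connected[of T S] inside_Un_outside[of S] by blast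

lemma arc_minus_ends:
  fixes g :: "real \<Rightarrow> complex"
  assumes "arc g" "pathstart g = a" "pathfinish g = b"
  shows "connected (path_image g - {a, b})" "path_image g - {a, b} \<noteq> {}"
  using assms connected_simple_path_endless[of g] nonempty_simple_path_endless[of g]
  by (auto simp: arc_imp_simple_path)

text \<open>The end points of an arc are limits of its inner points, since the open unit interval is
  dense in the closed one.\<close>

lemma arc_subset_closed:
  fixes g :: "real \<Rightarrow> complex"
  assumes "arc g" "pathstart g = a" "pathfinish g = b" "closed T" "path_image g - {a, b} \<subseteq> T"
  shows "path_image g \<subseteq> T"
proof -
  have "g ` {0<..<1} \<subseteq> T"
    using assms simple_path_endless[of g] by (auto simp: arc_imp_simple_path)
  moreover have "continuous_on (closure {0<..<1}) g"
    using assms(1) by (simp add: arc_def path_def)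
  ultimately have "g ` closure {0<..<1} \<subseteq> T"
    using assms(4) by (intro image_closure_subset)
  then show ?thesis by (simp add: path_image_def)
qed

text \<open>Each of the two insides is connected and, since the remaining arc runs outside, avoids
  the other closed curve. If they met, each would contain the other; equal regions have equal
  frontiers, so the inner points of \<open>f\<close> would lie on the other two arcs.\<close>

lemma theta_insides_disjoint:
  fixes f g h :: "real \<Rightarrow> complex"
  assumes "arc f" "arc g" "arc h"
    and "pathstart f = a" "pathfinish f = b" "pathstart g = a" "pathfinish g = b"
    and "pathstart h = a" "pathfinish h = b"
    and "path_image f \<inter> path_image g = {a, b}" "path_image f \<inter> path_image h = {a, b}"
    and "path_image g \<inter> path_image h = {a, b}"
    and f: "path_image f - {a, b} \<subseteq> outside (path_image g \<union> path_image h)"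
    and h: "path_image h - {a, b} \<subseteq> outside (path_image f \<union> path_image g)"
  shows "inside (path_image g \<union> path_image h) \<inter> inside (path_image f \<union> path_image g) = {}"
proof (rule ccontr)
  let ?A = "path_image f" and ?B = "path_image g" and ?C = "path_image h"
  assume ne: "\<not> ?thesis"
  note BC = theta_Jordan[OF assms(2,3,6,7,8,9,12)] and AB = theta_Jordan[OF assms(1,2,4,5,6,7,10)]
  have abs: "a \<in> ?B" "b \<in> ?B" using assms by auto
  have "inside (?B \<union> ?C) \<inter> (?A \<union> ?B) = {}"
    using inside_Un_Int_empty[OF f abs] .
  then have 1: "inside (?B \<union> ?C) \<subseteq> inside (?A \<union> ?B)"
    using connected_disjoint_inside_or_outside[OF BC(3)] ne insideD(2) by (metis disjoint_iff subsetD)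
  have "inside (?A \<union> ?B) \<inter> (?B \<union> ?C) = {}"
    using inside_Un_Int_empty[of ?C a b ?B ?A] h abs by (simp add: Un_commute)
  then have "inside (?A \<union> ?B) \<subseteq> inside (?B \<union> ?C)"
    using connected_disjoint_inside_or_outside[OF AB(3)] ne insideD(2) by (metis disjoint_iff subsetD)
  with 1 have "?A \<union> ?B = ?B \<union> ?C"
    using BC(5) AB(5) by (metis subset_antisym)
  then show False
    using arc_minus_ends(2)[OF assms(1,4,5)] assms(10,11) by blast
qed

text \<open>Otherwise every arc runs outside the cycle of the other two. A point \<open>q\<close>
  inside the cycle of \<open>g\<close> and \<open>h\<close> is then outside the two cycles through
  \<open>f\<close>, by \<open>theta_insides_disjoint\<close>. Connecting \<open>q\<close> to a point
  \<open>u\<close> outside all three arcs contradicts the choice of \<open>q\<close>.\<close>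

lemma theta_arc_inside:
  fixes f g h :: "real \<Rightarrow> complex"
  assumes "arc f" "arc g" "arc h"
    and "pathstart f = a" "pathfinish f = b" "pathstart g = a" "pathfinish g = b"
    and "pathstart h = a" "pathfinish h = b"
    and "path_image f \<inter> path_image g = {a, b}" "path_image f \<inter> path_image h = {a, b}"
    and "path_image g \<inter> path_image h = {a, b}"
  shows "path_image f - {a, b} \<subseteq> inside (path_image g \<union> path_image h) \<or>
    path_image g - {a, b} \<subseteq> inside (path_image f \<union> path_image h) \<or>
    path_image h - {a, b} \<subseteq> inside (path_image f \<union> path_image g)"
proof (rule ccontr)
  let ?A = "path_image f" and ?B = "path_image g" and ?C = "path_image h"
  assume no: "\<not> ?thesis"
  note BC = theta_Jordan[OF assms(2,3,6,7,8,9,12)] and AB = theta_Jordan[OF assms(1,2,4,5,6,7,10)]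
    and AC = theta_Jordan[OF assms(1,3,4,5,8,9,11)]
  have A: "?A - {a, b} \<subseteq> outside (?B \<union> ?C)"
    using connected_disjoint_inside_or_outside[OF arc_minus_ends(1)[OF assms(1,4,5)], of "?B \<union> ?C"]
      no assms(10-12) by blast
  have B: "?B - {a, b} \<subseteq> outside (?A \<union> ?C)"
    using connected_disjoint_inside_or_outside[OF arc_minus_ends(1)[OF assms(2,6,7)], of "?A \<union> ?C"]
      no assms(10-12) by blast
  have C: "?C - {a, b} \<subseteq> outside (?A \<union> ?B)"
    using connected_disjoint_inside_or_outside[OF arc_minus_ends(1)[OF assms(3,8,9)], of "?A \<union> ?B"]
      no assms(10-12) by blast
  obtain q where q: "q \<in> inside (?B \<union> ?C)" using BC(1) by blast
  have qBC: "q \<notin> ?B" "q \<notin> ?C" using insideD(1)[OF q] by auto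
  have "{a, b} \<subseteq> ?B" using assms(12) by blast
  then have qA: "q \<notin> ?A"
    using qBC(1) insideD(2)[OF q] A by auto
  have "q \<notin> inside (?A \<union> ?B)"
    using theta_insides_disjoint[OF assms A C] q by blast
  then have qAB: "q \<in> outside (?A \<union> ?B)"
    using outsideI qA qBC by blast
  have "q \<notin> inside (?A \<union> ?C)"
    using theta_insides_disjoint[OF assms(1,3,2,4,5,8,9,6,7,11,10)] A B q assms(12)
    by (auto simp: Un_commute Int_commute)
  then have qAC: "q \<in> outside (?A \<union> ?C)"
    using outsideI qA qBC by blast
  have "bounded (?A \<union> ?B \<union> ?C)"
    using assms(1-3) by (simp add: bounded_arc_image)
  then have "outside (?A \<union> ?B \<union> ?C) \<noteq> {}"
    using unbounded_outside by fastforce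
  then obtain u where u: "u \<in> outside (?A \<union> ?B \<union> ?C)" by blast
  have u': "u \<in> outside (?A \<union> ?B)" "u \<in> outside (?A \<union> ?C)" "u \<in> outside (?B \<union> ?C)"
    using u outside_mono[of "?A \<union> ?B" "?A \<union> ?B \<union> ?C"] outside_mono[of "?A \<union> ?C" "?A \<union> ?B \<union> ?C"]
      outside_mono[of "?B \<union> ?C" "?A \<union> ?B \<union> ?C"] by auto
  \<comment> \<open>Janiszewski's theorem: \<open>u\<close> and \<open>q\<close> are not separated
    by either of two compact sets, and these sets meet in the connected set \<open>?A\<close>, so
    their union does not separate \<open>u\<close> and \<open>q\<close> either.\<close>
  have "connected_component (- (?A \<union> ?B)) u q"
    unfolding connected_component_def using AB(4) u'(1) qAB outside_no_overlap[of "?A \<union> ?B"]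
    by (metis disjoint_eq_subset_Compl)
  moreover have "connected_component (- (?A \<union> ?C)) u q"
    unfolding connected_component_def using AC(4) u'(2) qAC outside_no_overlap[of "?A \<union> ?C"]
    by (metis disjoint_eq_subset_Compl)
  moreover have "(?A \<union> ?B) \<inter> (?A \<union> ?C) = ?A"
    using assms(10-12) by blast
  moreover have "connected ?A"
    using assms(1) by (simp add: connected_arc_image)
  ultimately have "connected_component (- ((?A \<union> ?B) \<union> (?A \<union> ?C))) u q"
    using Janiszewski[OF AB(6) compact_imp_closed[OF AC(6)]] by simp
  then have "connected_component (- (?B \<union> ?C)) u q"
    by (rule connected_component_of_subset) auto
  then have "q \<in> outside (?B \<union> ?C)"
    using u'(3) unfolding outside by (metis connected_component_eq mem_Collect_eq)
  then show False using insideD(2)[OF q] by simp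
qed

text \<open>The chord \<open>f\<close> cuts the inside of the cycle into a region at
  \<open>g\<close> and a region at \<open>h\<close>. The inner part of \<open>e\<close> is connected
  and misses \<open>f\<close>, so it stays in one region, and the ends of \<open>e\<close> belong to
  the closure of that region. But \<open>c\<close> is not in the closure of the region at
  \<open>h\<close>, and \<open>d\<close> is not in the closure of the region at
  \<open>g\<close>.\<close>

lemma crossing_arcs_inside:
  fixes e f g h :: "real \<Rightarrow> complex"
  assumes "arc e" "pathstart e = c" "pathfinish e = d"
    and "arc f" "arc g" "arc h"
    and "pathstart f = a" "pathfinish f = b" "pathstart g = a" "pathfinish g = b"
    and "pathstart h = a" "pathfinish h = b" "a \<noteq> b"
    and "path_image f \<inter> path_image g = {a, b}" "path_image f \<inter> path_image h = {a, b}"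
    and "path_image g \<inter> path_image h = {a, b}"
    and "path_image e \<inter> path_image f = {}" "path_image e \<inter> (path_image g \<union> path_image h) = {c, d}"
    and c: "c \<in> path_image g - {a, b}" and d: "d \<in> path_image h - {a, b}"
    and f: "path_image f - {a, b} \<subseteq> inside (path_image g \<union> path_image h)"
    and e: "path_image e - {c, d} \<subseteq> inside (path_image g \<union> path_image h)"
  shows False
proof -
  let ?E = "path_image e" and ?A = "path_image f" and ?B = "path_image g" and ?C = "path_image h"
  have "?A \<inter> inside (?B \<union> ?C) \<noteq> {}"
    using f arc_minus_ends(2)[OF assms(4,7,8)] by blast
  with assms have split: "inside (?B \<union> ?A) \<inter> inside (?C \<union> ?A) = {}"
    "inside (?B \<union> ?A) \<union> inside (?C \<union> ?A) \<union> (?A - {a, b}) = inside (?B \<union> ?C)"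
    using split_inside_simple_closed_curve[of g a b h f]
    by (simp_all add: Int_commute arc_imp_simple_path)
  have BA: "?B \<inter> ?A = {a, b}" "?C \<inter> ?A = {a, b}" using assms by auto
  note B = theta_Jordan[OF assms(5,4,9,10,7,8) BA(1)] and C = theta_Jordan[OF assms(6,4,11,12,7,8) BA(2)]
  have sub: "?E - {c, d} \<subseteq> inside (?B \<union> ?A) \<union> inside (?C \<union> ?A)"
    using e assms(17) unfolding split(2)[symmetric] by blast
  have con: "connected (?E - {c, d})" "?E - {c, d} \<noteq> {}"
    using arc_minus_ends[OF assms(1-3)] by auto
  have "c \<notin> inside (?B \<union> ?C)" "d \<notin> inside (?B \<union> ?C)"
    using c d by (auto dest!: insideD(1))
  then have nin: "c \<notin> inside (?C \<union> ?A)" "d \<notin> inside (?B \<union> ?A)"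
    unfolding split(2)[symmetric] by auto
  have cd: "c \<notin> ?C" "d \<notin> ?B" using c d assms(16) by blast+
  have cdE: "c \<in> ?E" "d \<in> ?E" using assms(2,3) by auto
  consider "?E - {c, d} \<subseteq> inside (?B \<union> ?A)" | "?E - {c, d} \<subseteq> inside (?C \<union> ?A)"
  proof -
    have "inside (?B \<union> ?A) \<inter> inside (?C \<union> ?A) \<inter> (?E - {c, d}) = {}"
      using split(1) by simp
    then have "inside (?B \<union> ?A) \<inter> (?E - {c, d}) = {} \<or> inside (?C \<union> ?A) \<inter> (?E - {c, d}) = {}"
      using connectedD[OF con(1) B(2) C(2)] sub by blast
    then show thesis
      using sub that by blast
  qed
  then show False
  proof cases
    case 1
    then have "?E \<subseteq> (?B \<union> ?A) \<union> inside (?B \<union> ?A)"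
      by (intro arc_subset_closed[OF assms(1-3) B(7)]) blast
    then show False
      using cdE cd nin assms(17) by blast
  next
    case 2
    then have "?E \<subseteq> (?C \<union> ?A) \<union> inside (?C \<union> ?A)"
      by (intro arc_subset_closed[OF assms(1-3) C(7)]) blast
    then show False
      using cdE cd nin assms(17) by blast
  qed
qed

section \<open>Outerplanar drawings\<close>

lemma pair_graph_sym: "pair_graph G \<Longrightarrow> sym (parcs G)"
  using pair_sym_digraph.arcs_symmetric
  by (metis pair_graph_def pair_pseudo_graph_def symI)

lemma pair_graph_arcs:
  assumes "pair_graph G" "(u, v) \<in> parcs G"
  shows "u \<in> pverts G \<and> v \<in> pverts G \<and> u \<noteq> v"
  using assms pair_wf_digraph.wellformed' pair_loopfree_digraph.no_loops'
  by (metis pair_graph_def pair_digraph_def pair_pseudo_graph_def pair_fin_digraph_def)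

section \<open>Walks as vertex lists, and their edge sets\<close>

abbreviation walk :: "('a \<times> 'a) set \<Rightarrow> 'a list \<Rightarrow> bool" where
  "walk E \<equiv> successively (\<lambda>x y. (x, y) \<in> E)"

lemma walk_split: "walk E (xs @ y # ys) \<longleftrightarrow> walk E (xs @ [y]) \<and> walk E (y # ys)"
proof (induction xs)
  case (Cons x xs)
  then show ?case by (cases xs) auto
qed auto

lemma walk_snoc: "walk E (xs @ [y]) \<longleftrightarrow> walk E xs \<and> (xs = [] \<or> (last xs, y) \<in> E)"
  by (auto simp: successively_append_iff)

lemma walk_rev:
  assumes "sym E"
  shows "walk E (rev p) = walk E p"
proof -
  have "(\<lambda>x y. (y, x) \<in> E) = (\<lambda>x y. (x, y) \<in> E)"
    using assms by (auto simp: fun_eq_iff dest: symD)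
  then show ?thesis unfolding successively_rev by (rule arg_cong)
qed

fun path_edges :: "'a list \<Rightarrow> 'a set set" where
  "path_edges (x # y # zs) = insert {x, y} (path_edges (y # zs))"
| "path_edges _ = {}"

lemma Union_path_edges: "\<Union> (path_edges p) \<subseteq> set p"
  by (induction p rule: path_edges.induct) auto

lemma Union_path_edges_eq: "2 \<le> length p \<Longrightarrow> \<Union> (path_edges p) = set p"
proof (induction p rule: path_edges.induct)
  case (1 x y zs)
  then show ?case by (cases zs) auto
qed auto

lemma path_edges_append: "path_edges (xs @ y # ys) = path_edges (xs @ [y]) \<union> path_edges (y # ys)"
proof (induction xs)
  case (Cons x xs)
  then show ?case by (cases xs) auto
qed auto

lemma path_edges_rev: "path_edges (rev p) = path_edges p"
proof (induction p rule: path_edges.induct)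
  case (1 x y zs)
  then show ?case
    using path_edges_append[of "rev zs" y "[x]"] by (auto simp: insert_commute)
qed auto

lemma path_edges_subset_edges: "walk (parcs G) p \<Longrightarrow> path_edges p \<subseteq> edges G"
  by (induction p rule: path_edges.induct) (auto simp: edges_def)

lemma end_edge_notin_path_edges:
  assumes "distinct (a # xs @ [b])" "xs \<noteq> []"
  shows "{a, b} \<notin> path_edges (a # xs @ [b])"
proof -
  obtain y ys where xs: "xs = y # ys" using assms(2) by (cases xs) auto
  have "e \<subseteq> set (y # ys @ [b])" if "e \<in> path_edges (y # ys @ [b])" for e
    using that Union_path_edges[of "y # ys @ [b]"] by blast
  then have "{a, b} \<notin> path_edges (y # ys @ [b])" using assms xs by auto
  moreover have "{a, b} \<noteq> {a, y}" using assms xs by (auto simp: doubleton_eq_iff)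
  ultimately show ?thesis using xs by simp
qed

lemma card_path_edges: "distinct p \<Longrightarrow> e \<in> path_edges p \<Longrightarrow> card e = 2"
  by (induction p rule: path_edges.induct) auto

text \<open>\<open>inside J\<close> is open and disjoint from \<open>outside D\<close>, hence also
  from its closure. Through this lemma the condition that all vertices lie on the outer face enters
  the proof.\<close>

lemma frontier_outside_notin_inside:
  fixes x :: complex
  assumes "x \<in> frontier (outside D)" "J \<subseteq> D" "closed J"
  shows "x \<notin> inside J"
proof
  assume x: "x \<in> inside J"
  have "inside J \<inter> outside D = {}"
    using insideD(2) outside_mono[OF assms(2)] by blast
  then have "inside J \<inter> closure (outside D) = {}"
    using open_inside[OF assms(3)] by (simp add: open_Int_closure_eq_empty)
  then show False
    using x assms(1) by (auto simp: frontier_def)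
qed

section \<open>Thetas and chords in an outerplanar drawing\<close>

locale outerplane_graph =
  fixes G :: "'a pair_pre_digraph" and \<phi> :: "'a \<Rightarrow> complex" and \<gamma> :: "'a set \<Rightarrow> complex set"
  assumes graph: "pair_graph G"
    and emb: "plane_embedding G \<phi> \<gamma>"
    and outer: "\<phi> ` pverts G \<subseteq> frontier (outside (drawing G \<phi> \<gamma>))"
begin

definition path_drawing :: "'a list \<Rightarrow> complex set" where
  "path_drawing p = \<Union> (\<gamma> ` path_edges p)"

lemmas sym_arcs = pair_graph_sym[OF graph] and arcs_in_verts = pair_graph_arcs[OF graph]

lemma inj: "inj_on \<phi> (pverts G)"
  using emb by (simp add: plane_embedding_def)

lemma edge_arc:
  assumes "(u, v) \<in> parcs G"
  obtains g where "arc g" "pathstart g = \<phi> u" "pathfinish g = \<phi> v" "path_image g = \<gamma> {u, v}"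
  using emb assms unfolding plane_embedding_def by blast

lemma edges_Int: "e \<in> edges G \<Longrightarrow> f \<in> edges G \<Longrightarrow> e \<noteq> f \<Longrightarrow> \<gamma> e \<inter> \<gamma> f = \<phi> ` (e \<inter> f)"
  using emb unfolding plane_embedding_def by blast

lemma walk_in_verts: "walk (parcs G) p \<Longrightarrow> 2 \<le> length p \<Longrightarrow> set p \<subseteq> pverts G"
proof (induction p rule: path_edges.induct)
  case (1 x y zs)
  then show ?case by (cases zs) (auto dest: arcs_in_verts)
qed auto

lemma path_arc:
  assumes "walk (parcs G) p" "distinct p" "2 \<le> length p"
  shows "\<exists>g. arc g \<and> pathstart g = \<phi> (hd p) \<and> pathfinish g = \<phi> (last p) \<and>
    path_image g = path_drawing p"
  using assms
proof (induction p rule: path_edges.induct)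
  case (1 x y zs)
  then have xy: "(x, y) \<in> parcs G" by simp
  obtain g where g: "arc g" "pathstart g = \<phi> x" "pathfinish g = \<phi> y" "path_image g = \<gamma> {x, y}"
    using edge_arc[OF xy] .
  show ?case
  proof (cases zs)
    case Nil
    then show ?thesis using g by (auto simp: path_drawing_def)
  next
    case (Cons z zs')
    with 1 obtain h where h: "arc h" "pathstart h = \<phi> y" "pathfinish h = \<phi> (last (y # zs))"
      "path_image h = path_drawing (y # zs)" by auto
    have "\<gamma> {x, y} \<inter> \<gamma> e \<subseteq> {\<phi> y}" if e: "e \<in> path_edges (y # zs)" for e
    proof -
      have "x \<notin> e" using Union_path_edges[of "y # zs"] e 1(3) by auto
      moreover have "e \<in> edges G" "{x, y} \<in> edges G"
        using path_edges_subset_edges[OF 1(2)] e by auto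
      ultimately show ?thesis using edges_Int[of "{x, y}" e] by auto
    qed
    then have "path_image g \<inter> path_image h \<subseteq> {pathstart h}"
      using g h by (auto simp: path_drawing_def)
    with g h have "arc (g +++ h)" by (intro arc_join) auto
    then show ?thesis
      using g h by (intro exI[of _ "g +++ h"]) (auto simp: path_image_join path_drawing_def)
  qed
qed auto

lemma vertex_on_path_drawing:
  assumes "walk (parcs G) p" "2 \<le> length p" "x \<in> set p"
  shows "\<phi> x \<in> path_drawing p"
proof -
  obtain e where e: "e \<in> path_edges p" "x \<in> e"
    using Union_path_edges_eq[OF assms(2)] assms(3) by blast
  then obtain u v where uv: "(u, v) \<in> parcs G" "e = {u, v}"
    using path_edges_subset_edges[OF assms(1)] by (auto simp: edges_def)
  obtain g where "pathstart g = \<phi> u" "pathfinish g = \<phi> v" "path_image g = \<gamma> {u, v}"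
    using edge_arc[OF uv(1)] .
  then have "\<phi> x \<in> \<gamma> e"
    using e uv pathstart_in_path_image[of g] pathfinish_in_path_image[of g] by auto
  then show ?thesis using e by (auto simp: path_drawing_def)
qed

lemma path_drawing_Int:
  assumes "walk (parcs G) p" "2 \<le> length p" "walk (parcs G) q" "2 \<le> length q"
    and "path_edges p \<inter> path_edges q = {}"
  shows "path_drawing p \<inter> path_drawing q = \<phi> ` (set p \<inter> set q)"
proof
  show "\<phi> ` (set p \<inter> set q) \<subseteq> path_drawing p \<inter> path_drawing q"
    using vertex_on_path_drawing assms by auto
  show "path_drawing p \<inter> path_drawing q \<subseteq> \<phi> ` (set p \<inter> set q)"
  proof
    fix z assume "z \<in> path_drawing p \<inter> path_drawing q"
    then obtain e f where ef: "e \<in> path_edges p" "f \<in> path_edges q" "z \<in> \<gamma> e" "z \<in> \<gamma> f"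
      by (auto simp: path_drawing_def)
    then have "z \<in> \<phi> ` (e \<inter> f)"
      using edges_Int[of e f] path_edges_subset_edges[OF assms(1)]
        path_edges_subset_edges[OF assms(3)] assms(5) by blast
    then show "z \<in> \<phi> ` (set p \<inter> set q)"
      using Union_path_edges[of p] Union_path_edges[of q] ef by blast
  qed
qed

text \<open>A common edge of the two paths would have both ends among the common vertices
  \<open>a\<close> and \<open>b\<close>, so it would be the edge \<open>{a, b}\<close>; a path from
  \<open>a\<close> to \<open>b\<close> with an inner vertex does not contain that edge. Hence one
  nonempty middle part suffices, and the other path may be a chord.\<close>

lemma path_drawing_theta_Int:
  assumes "walk (parcs G) (a # xs @ [b])" "walk (parcs G) (a # ys @ [b])"
    and "distinct (a # b # xs @ ys)" "ys \<noteq> []"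
  shows "path_drawing (a # xs @ [b]) \<inter> path_drawing (a # ys @ [b]) = {\<phi> a, \<phi> b}"
proof -
  have "e \<notin> path_edges (a # ys @ [b])" if e: "e \<in> path_edges (a # xs @ [b])" for e
  proof
    assume e': "e \<in> path_edges (a # ys @ [b])"
    have "e \<subseteq> set (a # xs @ [b])" "e \<subseteq> set (a # ys @ [b])"
      using Union_path_edges[of "a # xs @ [b]"] Union_path_edges[of "a # ys @ [b]"] e e'
      by (metis Union_upper order_trans)+
    then have "e \<subseteq> {a, b}" using assms(3) by auto
    moreover have "card e = 2" using card_path_edges[OF _ e] assms(3) by auto
    moreover have "card {a, b} = 2" using assms(3) by auto
    ultimately have "e = {a, b}" by (intro card_subset_eq) auto
    then show False using end_edge_notin_path_edges[of a ys b] e' assms(3,4) by auto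
  qed
  then have "path_drawing (a # xs @ [b]) \<inter> path_drawing (a # ys @ [b]) =
      \<phi> ` (set (a # xs @ [b]) \<inter> set (a # ys @ [b]))"
    using assms by (intro path_drawing_Int) auto
  also have "set (a # xs @ [b]) \<inter> set (a # ys @ [b]) = {a, b}" using assms(3) by auto
  finally show ?thesis by simp
qed

lemma vertex_notin_inside:
  assumes "x \<in> pverts G" "walk (parcs G) p" "walk (parcs G) q" "closed (path_drawing p \<union> path_drawing q)"
  shows "\<phi> x \<notin> inside (path_drawing p \<union> path_drawing q)"
proof (rule frontier_outside_notin_inside)
  show "\<phi> x \<in> frontier (outside (drawing G \<phi> \<gamma>))" using outer assms(1) by blast
  show "path_drawing p \<union> path_drawing q \<subseteq> drawing G \<phi> \<gamma>"
    using path_edges_subset_edges[OF assms(2)] path_edges_subset_edges[OF assms(3)]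
    by (auto simp: path_drawing_def drawing_def)
qed fact

text \<open>One of the three arcs lies inside the cycle of the other two, and such an arc carries no
  inner vertex because vertices are on the outer face. As \<open>ys\<close> and \<open>zs\<close>
  are nonempty, it must be the arc through \<open>xs\<close>. The first conclusion locates chords,
  the second forbids thetas.\<close>

lemma theta_inside:
  assumes w: "walk (parcs G) (a # xs @ [b])" "walk (parcs G) (a # ys @ [b])" "walk (parcs G) (a # zs @ [b])"
    and d: "distinct (a # b # xs @ ys @ zs)" and ne: "ys \<noteq> []" "zs \<noteq> []"
  shows "path_drawing (a # xs @ [b]) - {\<phi> a, \<phi> b} \<subseteq>
      inside (path_drawing (a # ys @ [b]) \<union> path_drawing (a # zs @ [b]))" and "xs = []"
proof -
  let ?A = "path_drawing (a # xs @ [b])" and ?B = "path_drawing (a # ys @ [b])"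
    and ?C = "path_drawing (a # zs @ [b])"
  have "distinct (a # xs @ [b])" "distinct (a # ys @ [b])" "distinct (a # zs @ [b])"
    using d by auto
  then obtain f g h where f: "arc f" "pathstart f = \<phi> a" "pathfinish f = \<phi> b" "path_image f = ?A"
    and g: "arc g" "pathstart g = \<phi> a" "pathfinish g = \<phi> b" "path_image g = ?B"
    and h: "arc h" "pathstart h = \<phi> a" "pathfinish h = \<phi> b" "path_image h = ?C"
    using path_arc[OF w(1)] path_arc[OF w(2)] path_arc[OF w(3)] by auto
  have int: "?A \<inter> ?B = {\<phi> a, \<phi> b}" "?A \<inter> ?C = {\<phi> a, \<phi> b}" "?B \<inter> ?C = {\<phi> a, \<phi> b}"
    using path_drawing_theta_Int[OF w(1,2)] path_drawing_theta_Int[OF w(1,3)]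
      path_drawing_theta_Int[OF w(2,3)] d ne by auto
  have cl: "closed ?A" "closed ?B" "closed ?C"
    using closed_arc_image f(1,4) g(1,4) h(1,4) by metis+
  have not_inside: "\<not> path_drawing (a # us @ [b]) - {\<phi> a, \<phi> b} \<subseteq> inside (path_drawing p \<union> path_drawing q)"
    if "walk (parcs G) (a # us @ [b])" "us \<noteq> []" "distinct (a # us @ [b])"
      "walk (parcs G) p" "walk (parcs G) q" "closed (path_drawing p \<union> path_drawing q)" for us p q
  proof
    assume sub: "path_drawing (a # us @ [b]) - {\<phi> a, \<phi> b} \<subseteq> inside (path_drawing p \<union> path_drawing q)"
    obtain u where u: "u \<in> set us" using \<open>us \<noteq> []\<close> by (cases us) auto
    have V: "set (a # us @ [b]) \<subseteq> pverts G" using walk_in_verts[OF that(1)] by simp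
    have "u \<noteq> a" "u \<noteq> b" using that(3) u by auto
    then have "\<phi> u \<noteq> \<phi> a" "\<phi> u \<noteq> \<phi> b" using inj V u by (auto dest: inj_onD)
    moreover have "\<phi> u \<in> path_drawing (a # us @ [b])"
      using vertex_on_path_drawing[OF that(1)] u by simp
    ultimately have "\<phi> u \<in> inside (path_drawing p \<union> path_drawing q)" using sub by blast
    then show False using vertex_notin_inside[OF _ that(4-6)] u V by auto
  qed
  have B: "\<not> ?B - {\<phi> a, \<phi> b} \<subseteq> inside (?A \<union> ?C)"
    using not_inside[OF w(2) ne(1) _ w(1,3)] d cl by auto
  have C: "\<not> ?C - {\<phi> a, \<phi> b} \<subseteq> inside (?A \<union> ?B)"
    using not_inside[OF w(3) ne(2) _ w(1,2)] d cl by auto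
  show A: "?A - {\<phi> a, \<phi> b} \<subseteq> inside (?B \<union> ?C)"
    using theta_arc_inside[OF f(1) g(1) h(1) f(2,3) g(2,3) h(2,3)] int B C
    unfolding f(4) g(4) h(4) by blast
  then show "xs = []"
    using not_inside[OF w(1) _ _ w(2,3)] d cl by auto
qed

text \<open>By \<open>theta_inside\<close>, each of the two chords lies inside the cycle. There
  chords with alternating ends would have to meet, whereas distinct edges without a common end are
  drawn disjointly.\<close>

lemma no_crossing_chords:
  assumes w: "walk (parcs G) (a # ws @ c # xs @ [b])" "walk (parcs G) (a # ys @ d # zs @ [b])"
    and dist: "distinct (a # b # c # d # ws @ xs @ ys @ zs)"
    and ab: "(a, b) \<in> parcs G" and cd: "(c, d) \<in> parcs G"
  shows False
proof -
  \<comment> \<open>One cycle, in cyclic order \<open>a, ws, c, xs, b, rev zs, d, rev ys\<close>, is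
    cut in two ways: \<open>?P\<close> and \<open>?Q\<close> are its sides between \<open>a\<close>
    and \<open>b\<close>, \<open>?R\<close> and \<open>?S\<close> its sides between \<open>c\<close>
    and \<open>d\<close>. The equation \<open>RS\<close> below states that both pairs of sides draw
    the same curve.\<close>
  let ?P = "a # (ws @ c # xs) @ [b]" and ?Q = "a # (ys @ d # zs) @ [b]"
  let ?R = "c # (rev ws @ a # ys) @ [d]" and ?S = "c # (xs @ b # rev zs) @ [d]"
  have wab: "walk (parcs G) ?P" "walk (parcs G) ?Q" using w by auto
  have "walk (parcs G) (a # ws @ [c])" "walk (parcs G) (c # xs @ [b])"
    "walk (parcs G) (a # ys @ [d])" "walk (parcs G) (d # zs @ [b])"
    using w walk_split[of "parcs G" "a # ws" c "xs @ [b]"] walk_split[of "parcs G" "a # ys" d "zs @ [b]"]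
    by auto
  then have "walk (parcs G) (rev (a # ws @ [c]))" "walk (parcs G) (c # xs @ [b])"
    "walk (parcs G) (a # ys @ [d])" "walk (parcs G) (rev (d # zs @ [b]))"
    using walk_rev[OF sym_arcs] by blast+
  then have wcd: "walk (parcs G) ?R" "walk (parcs G) ?S"
    using walk_split[of "parcs G" "c # rev ws" a "ys @ [d]"] walk_split[of "parcs G" "c # xs" b "rev zs @ [d]"]
    by auto
  have "path_edges ?R = path_edges (rev (a # ws @ [c])) \<union> path_edges (a # ys @ [d])"
    using path_edges_append[of "c # rev ws" a "ys @ [d]"] by simp
  moreover have "path_edges ?S = path_edges (c # xs @ [b]) \<union> path_edges (rev (d # zs @ [b]))"
    using path_edges_append[of "c # xs" b "rev zs @ [d]"] by simp
  moreover have "path_edges ?P = path_edges (a # ws @ [c]) \<union> path_edges (c # xs @ [b])"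
    using path_edges_append[of "a # ws" c "xs @ [b]"] by simp
  moreover have "path_edges ?Q = path_edges (a # ys @ [d]) \<union> path_edges (d # zs @ [b])"
    using path_edges_append[of "a # ys" d "zs @ [b]"] by simp
  ultimately have "path_edges ?R \<union> path_edges ?S = path_edges ?P \<union> path_edges ?Q"
    unfolding path_edges_rev by blast
  then have RS: "path_drawing ?R \<union> path_drawing ?S = path_drawing ?P \<union> path_drawing ?Q"
    unfolding path_drawing_def by (metis Union_Un_distrib image_Un)
  have wf: "walk (parcs G) (a # [] @ [b])" and we: "walk (parcs G) (c # [] @ [d])"
    using ab cd by auto
  have f_in: "path_drawing (a # [] @ [b]) - {\<phi> a, \<phi> b} \<subseteq> inside (path_drawing ?P \<union> path_drawing ?Q)"
    using dist by (intro theta_inside(1)[OF wf wab]) auto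
  have e_in: "path_drawing (c # [] @ [d]) - {\<phi> c, \<phi> d} \<subseteq> inside (path_drawing ?P \<union> path_drawing ?Q)"
    unfolding RS[symmetric] using dist by (intro theta_inside(1)[OF we wcd]) auto
  have dd: "distinct ?P" "distinct ?Q" "distinct [a, b]" "distinct [c, d]" using dist by auto
  obtain e f g h where
    e: "arc e" "pathstart e = \<phi> c" "pathfinish e = \<phi> d" "path_image e = path_drawing (c # [] @ [d])"
    and f: "arc f" "pathstart f = \<phi> a" "pathfinish f = \<phi> b" "path_image f = path_drawing (a # [] @ [b])"
    and g: "arc g" "pathstart g = \<phi> a" "pathfinish g = \<phi> b" "path_image g = path_drawing ?P"
    and h: "arc h" "pathstart h = \<phi> a" "pathfinish h = \<phi> b" "path_image h = path_drawing ?Q"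
    using path_arc[OF wab(1) dd(1)] path_arc[OF wab(2) dd(2)] path_arc[OF wf] path_arc[OF we] dd(3,4)
    by auto
  have int: "path_drawing (a # [] @ [b]) \<inter> path_drawing ?P = {\<phi> a, \<phi> b}"
    using dist by (intro path_drawing_theta_Int[OF wf wab(1)]) auto
  have int': "path_drawing (a # [] @ [b]) \<inter> path_drawing ?Q = {\<phi> a, \<phi> b}"
    using dist by (intro path_drawing_theta_Int[OF wf wab(2)]) auto
  have int'': "path_drawing ?P \<inter> path_drawing ?Q = {\<phi> a, \<phi> b}"
    using dist by (intro path_drawing_theta_Int[OF wab]) auto
  have "path_edges (c # [] @ [d]) \<inter> path_edges (a # [] @ [b]) = {}"
    using dist by (auto simp: doubleton_eq_iff)
  then have ef: "path_drawing (c # [] @ [d]) \<inter> path_drawing (a # [] @ [b]) = {}"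
    using path_drawing_Int[OF we _ wf] dist by auto
  have "path_drawing (c # [] @ [d]) \<inter> path_drawing ?R = {\<phi> c, \<phi> d}"
    using dist by (intro path_drawing_theta_Int[OF we wcd(1)]) auto
  moreover have "path_drawing (c # [] @ [d]) \<inter> path_drawing ?S = {\<phi> c, \<phi> d}"
    using dist by (intro path_drawing_theta_Int[OF we wcd(2)]) auto
  ultimately have e_int: "path_drawing (c # [] @ [d]) \<inter> (path_drawing ?P \<union> path_drawing ?Q) = {\<phi> c, \<phi> d}"
    unfolding RS[symmetric] by blast
  have V: "a \<in> pverts G" "b \<in> pverts G" "c \<in> pverts G" "d \<in> pverts G"
    using ab cd arcs_in_verts by auto
  have ne: "\<phi> a \<noteq> \<phi> b" "\<phi> c \<notin> {\<phi> a, \<phi> b}" "\<phi> d \<notin> {\<phi> a, \<phi> b}"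
    using V dist inj by (auto dest: inj_onD)
  have "\<phi> c \<in> path_drawing ?P" "\<phi> d \<in> path_drawing ?Q"
    using vertex_on_path_drawing[OF wab(1)] vertex_on_path_drawing[OF wab(2)] by auto
  with ne have c: "\<phi> c \<in> path_drawing ?P - {\<phi> a, \<phi> b}" and d: "\<phi> d \<in> path_drawing ?Q - {\<phi> a, \<phi> b}"
    by auto
  show False
    using crossing_arcs_inside[OF e(1-3) f(1) g(1) h(1) f(2,3) g(2,3) h(2,3) ne(1),
        unfolded e(4) f(4) g(4) h(4), OF int int' int'' ef e_int c d f_in e_in] .
qed

end

section \<open>Noncrossing vertex orders\<close>

text \<open>No subdivision of the complete bipartite graph \<open>K_{2,3}\<close>. Together with
  \<open>crossing_chord_free\<close>, which excludes subdivisions of \<open>K_4\<close> with two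
  opposite edges left undivided, this is all that is retained of the drawing.\<close>

definition theta_free :: "('a \<times> 'a) set \<Rightarrow> bool" where
  "theta_free E \<longleftrightarrow> (\<forall>a b xs ys zs. walk E (a # xs @ [b]) \<and> walk E (a # ys @ [b]) \<and>
     walk E (a # zs @ [b]) \<and> distinct (a # b # xs @ ys @ zs) \<longrightarrow> xs = [] \<or> ys = [] \<or> zs = [])"

definition crossing_chord_free :: "('a \<times> 'a) set \<Rightarrow> bool" where
  "crossing_chord_free E \<longleftrightarrow> (\<forall>a b c d ws xs ys zs. walk E (a # ws @ c # xs @ [b]) \<and>
     walk E (a # ys @ d # zs @ [b]) \<and> distinct (a # b # c # d # ws @ xs @ ys @ zs) \<and> (a, b) \<in> E
     \<longrightarrow> (c, d) \<notin> E)"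

definition noncrossing :: "('a \<times> 'a) set \<Rightarrow> 'a list \<Rightarrow> bool" where
  "noncrossing E p \<longleftrightarrow> (\<forall>i k j l. i < k \<and> k < j \<and> j < l \<and> l < length p \<longrightarrow>
     (p ! i, p ! j) \<in> E \<longrightarrow> (p ! k, p ! l) \<notin> E)"

lemma noncrossingD:
  "noncrossing E p \<Longrightarrow> i < k \<Longrightarrow> k < j \<Longrightarrow> j < l \<Longrightarrow> l < length p \<Longrightarrow> (p ! i, p ! j) \<in> E \<Longrightarrow> (p ! k, p ! l) \<notin> E"
  by (simp add: noncrossing_def)

text \<open>Interleaving of two pairs is a property of the cyclic order. If the moved vertex is an
  end of one of the edges, its new position is the last one and the two edges swap roles in the
  pattern \<open>i < k < j < l\<close>; its edge is then read backwards, which uses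
  symmetry.\<close>

lemma noncrossing_rotate1:
  assumes "noncrossing E (x # p)" "sym E"
  shows "noncrossing E (p @ [x])"
  unfolding noncrossing_def
proof (intro allI impI notI)
  fix i k j l
  assume *: "i < k \<and> k < j \<and> j < l \<and> l < length (p @ [x])"
    and ij: "((p @ [x]) ! i, (p @ [x]) ! j) \<in> E" and kl: "((p @ [x]) ! k, (p @ [x]) ! l) \<in> E"
  from * have lt: "i < length p" "j < length p" "k < length p" by auto
  have ij': "((x # p) ! Suc i, (x # p) ! Suc j) \<in> E" using ij lt by (simp add: nth_append)
  show False
  proof (cases "l < length p")
    case True
    then have "((x # p) ! Suc k, (x # p) ! Suc l) \<in> E" using kl lt by (simp add: nth_append)
    moreover have "Suc i < Suc k \<and> Suc k < Suc j \<and> Suc j < Suc l \<and> Suc l < length (x # p)"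
      using * True by simp
    ultimately show False using assms(1) ij' unfolding noncrossing_def by blast
  next
    case False
    then have "l = length p" using * by simp
    then have "((x # p) ! 0, (x # p) ! Suc k) \<in> E" using kl lt assms(2) by (auto simp: nth_append dest: symD)
    moreover have "0 < Suc i \<and> Suc i < Suc k \<and> Suc k < Suc j \<and> Suc j < length (x # p)"
      using * lt by simp
    ultimately show False using assms(1) ij' unfolding noncrossing_def by blast
  qed
qed

lemma noncrossing_rotate: "noncrossing E (u @ v) \<Longrightarrow> sym E \<Longrightarrow> noncrossing E (v @ u)"
proof (induction u arbitrary: v)
  case (Cons x u)
  then show ?case using noncrossing_rotate1[of E x "u @ v"] Cons.IH[of "v @ [x]"] by simp
qed simp

text \<open>Every edge lies within \<open>p @ r\<close> or within \<open>r @ q\<close>. For edges on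
  different sides, the interleaving positions \<open>k < j\<close> would both have to fall into
  \<open>r\<close>, which has at most one entry; so crossing edges lie on the same side.\<close>

lemma noncrossing_glue:
  assumes "noncrossing E (p @ r)" "noncrossing E (r @ q)" "length r \<le> 1" "sym E"
    and "\<And>x y. x \<in> set p \<Longrightarrow> y \<in> set q \<Longrightarrow> (x, y) \<notin> E"
  shows "noncrossing E (p @ r @ q)"
  unfolding noncrossing_def
proof (intro allI impI notI)
  let ?s = "p @ r @ q"
  fix i k j l
  assume *: "i < k \<and> k < j \<and> j < l \<and> l < length ?s"
    and ij: "(?s ! i, ?s ! j) \<in> E" and kl: "(?s ! k, ?s ! l) \<in> E"
  have side: "j < length p + length r \<or> length p \<le> i"
    if "i < j" "j < length ?s" "(?s ! i, ?s ! j) \<in> E" for i j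
  proof (rule ccontr)
    assume no: "\<not> ?thesis"
    then have "?s ! i \<in> set p" by (simp add: nth_append)
    moreover have "?s ! j \<in> set q" using no that(2) by (auto simp: nth_append)
    ultimately show False using that(3) assms(5) by blast
  qed
  consider "j < length p + length r" | "length p \<le> i"
    using side[of i j] * ij by auto
  then show False
  proof cases
    case 1
    then have "k < length p" using * assms(3) by linarith
    then have l: "l < length p + length r" using side[of k l] * kl by auto
    then have "((p @ r) ! i, (p @ r) ! j) \<in> E" "((p @ r) ! k, (p @ r) ! l) \<in> E"
      using ij kl * by (auto simp: nth_append split: if_splits)
    moreover have "i < k \<and> k < j \<and> j < l \<and> l < length (p @ r)" using * l by simp
    ultimately show False using assms(1) unfolding noncrossing_def by blast
  next
    case 2
    then have "\<And>m. i \<le> m \<Longrightarrow> ?s ! m = (r @ q) ! (m - length p)"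
      by (auto simp: nth_append)
    then have "((r @ q) ! (i - length p), (r @ q) ! (j - length p)) \<in> E"
      "((r @ q) ! (k - length p), (r @ q) ! (l - length p)) \<in> E"
      using ij kl * by auto
    moreover have "i - length p < k - length p \<and> k - length p < j - length p \<and>
        j - length p < l - length p \<and> l - length p < length (r @ q)"
      using * 2 by auto
    ultimately show False using assms(2) unfolding noncrossing_def by blast
  qed
qed

section \<open>Cycles, separations and ears\<close>

lemma rtrancl_distinct_walk:
  assumes "(x, y) \<in> R\<^sup>*"
  shows "\<exists>q. q \<noteq> [] \<and> distinct q \<and> walk R q \<and> hd q = x \<and> last q = y"
  using assms
proof (induction rule: rtrancl_induct)
  case base
  show ?case by (intro exI[of _ "[x]"]) simp
next
  case (step y z)
  then obtain q where q: "q \<noteq> []" "distinct q" "walk R q" "hd q = x" "last q = y" by blast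
  show ?case
  proof (cases "z \<in> set q")
    case True
    then obtain u v where uv: "q = u @ z # v" by (auto simp: in_set_conv_decomp)
    then have "hd (u @ [z]) = x" using q(4) by (cases u) auto
    then show ?thesis
      using q uv walk_split[of R u z v] by (intro exI[of _ "u @ [z]"]) auto
  next
    case False
    then show ?thesis
      using q step(2) by (intro exI[of _ "q @ [z]"]) (auto simp: successively_append_iff)
  qed
qed

definition cycle_list :: "('a \<times> 'a) set \<Rightarrow> 'a list \<Rightarrow> bool" where
  "cycle_list E p \<longleftrightarrow> distinct p \<and> 2 \<le> length p \<and> walk E p \<and> (last p, hd p) \<in> E"

lemma cycle_list_rotate:
  assumes "cycle_list E (u @ v)"
  shows "cycle_list E (v @ u)"
proof (cases "u = [] \<or> v = []")
  case False
  then show ?thesis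
    using assms by (auto simp: cycle_list_def successively_append_iff)
qed (use assms in auto)

text \<open>The vertices \<open>a\<close> and \<open>b\<close> divide the cycle into two sides
  \<open>xs\<close> and \<open>ys\<close>. If both were nonempty, they would form a theta with the
  path \<open>q\<close>. So \<open>a\<close> and \<open>b\<close> are neighbours on the cycle, and
  \<open>q\<close> can be inserted between them.\<close>

lemma cycle_list_ear:
  assumes cyc: "cycle_list E p" and ab: "a \<in> set p" "b \<in> set p" "a \<noteq> b"
    and q: "q \<noteq> []" "distinct q" "walk E q" "(a, hd q) \<in> E" "(last q, b) \<in> E" "set q \<inter> set p = {}"
    and E: "sym E" "theta_free E"
  shows "\<exists>p'. cycle_list E p' \<and> set p' \<subseteq> set p \<union> set q \<and> length p < length p'"
proof -
  obtain u v where uv: "p = u @ a # v" using ab(1) by (auto simp: in_set_conv_decomp)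
  define r where "r = v @ u"
  have cr: "cycle_list E (a # r)"
    using cycle_list_rotate[of E u "a # v"] cyc uv by (simp add: r_def)
  have sr: "set (a # r) = set p" "length (a # r) = length p" using uv by (auto simp: r_def)
  have "b \<in> set r" using ab sr by auto
  then obtain xs ys where xys: "r = xs @ b # ys" by (auto simp: in_set_conv_decomp)
  have w: "walk E (a # xs @ [b])" "walk E (b # ys)" "(last (b # ys), a) \<in> E"
    using cr walk_split[of E "a # xs" b ys] by (auto simp: xys cycle_list_def)
  have wr: "walk E (rev q)" using walk_rev[OF E(1)] q(3) by blast
  have wq: "walk E (a # q @ [b])"
    using q by (auto simp: successively_append_iff successively_Cons)
  have dis: "distinct (a # xs @ b # ys @ q)"
    using cr q sr by (auto simp: cycle_list_def xys)
  show ?thesis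
  proof (cases "xs = [] \<or> ys = []")
    case True
    then show ?thesis
    proof
      assume "xs = []"
      have "walk E (a # q @ b # ys)"
        using walk_split[of E "a # q" b ys] wq w by simp
      then have "cycle_list E (a # q @ b # ys)"
        using dis w by (auto simp: cycle_list_def)
      then show ?thesis
        using sr q(1) \<open>xs = []\<close> by (intro exI[of _ "a # q @ b # ys"]) (auto simp: xys simp flip: length_greater_0_conv)
    next
      assume "ys = []"
      have "walk E (b # rev q @ [a])"
        using walk_rev[OF E(1), of "a # q @ [b]"] wq by simp
      then have "walk E (b # rev q)" "(last (b # rev q), a) \<in> E"
        using walk_snoc[of E "b # rev q" a] by simp_all
      then have "cycle_list E (a # xs @ b # rev q)"
        using walk_split[of E "a # xs" b "rev q"] dis w by (auto simp: cycle_list_def)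
      then show ?thesis
        using sr q(1) \<open>ys = []\<close> by (intro exI[of _ "a # xs @ b # rev q"]) (auto simp: xys simp flip: length_greater_0_conv)
    qed
  next
    case False
    have "walk E (b # ys @ [a])"
      using w walk_snoc[of E "b # ys" a] by simp
    then have "walk E (a # rev ys @ [b])"
      using walk_rev[OF E(1), of "b # ys @ [a]"] by simp
    moreover have "distinct (a # b # q @ xs @ rev ys)" using dis by auto
    ultimately show ?thesis
      using E(2) w(1) wq q(1) False unfolding theta_free_def by (metis rev_is_Nil_conv)
  qed
qed

text \<open>Interleaving edges are chords of the cycle with alternating ends. The cycle is rotated
  to start at \<open>a\<close>; its first side runs to \<open>b\<close> through \<open>c\<close>,
  and the second, read backwards from \<open>a\<close>, passes through \<open>d\<close>.\<close>

lemma cycle_list_noncrossing: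
  assumes cyc: "cycle_list E p" and E: "sym E" "crossing_chord_free E"
  shows "noncrossing E p"
  unfolding noncrossing_def
proof (intro allI impI notI)
  fix i k j l
  assume *: "i < k \<and> k < j \<and> j < l \<and> l < length p"
    and ij: "(p ! i, p ! j) \<in> E" and kl: "(p ! k, p ! l) \<in> E"
  have split: "drop m p = p ! m # take (n - Suc m) (drop (Suc m) p) @ drop n p" if "m < n" "n < length p" for m n
  proof -
    have "drop m p = p ! m # drop (Suc m) p" using that by (simp add: Cons_nth_drop_Suc)
    moreover have "drop (Suc m) p = take (n - Suc m) (drop (Suc m) p) @ drop n p"
      using that append_take_drop_id[of "n - Suc m" "drop (Suc m) p"] by simp
    ultimately show ?thesis by simp
  qed
  obtain u ws xs ys where "drop i p = p ! i # ws @ drop k p" "drop k p = p ! k # xs @ drop j p"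
    "drop j p = p ! j # ys @ drop l p" "p = u @ drop i p"
    using split[of i k] split[of k j] split[of j l] * append_take_drop_id[of i p] by (metis order.strict_trans)
  moreover have "drop l p = p ! l # drop (Suc l) p" using * by (simp add: Cons_nth_drop_Suc)
  ultimately obtain a b c d v where p: "p = u @ a # ws @ c # xs @ b # ys @ d # v"
    and abcd: "a = p ! i" "b = p ! j" "c = p ! k" "d = p ! l" by metis
  have "cycle_list E ((a # ws @ c # xs @ b # ys @ d # v) @ u)"
    using cycle_list_rotate[of E u] cyc unfolding p by blast
  then have w: "walk E (a # ws @ c # xs @ b # ys @ d # v @ u)" and last: "(last (d # v @ u), a) \<in> E"
    and dis: "distinct (a # ws @ c # xs @ b # ys @ d # v @ u)"
    by (auto simp: cycle_list_def)
  have w1: "walk E (a # ws @ c # xs @ [b])" and "walk E (b # ys @ d # v @ u)"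
    using w walk_split[of E "a # ws @ c # xs" b "ys @ d # v @ u"] by auto
  then have "walk E (b # ys @ d # v @ u @ [a])"
    using last walk_snoc[of E "b # ys @ d # v @ u" a] by simp
  then have "walk E (a # rev (v @ u) @ d # rev ys @ [b])"
    using walk_rev[OF E(1), of "b # ys @ d # v @ u @ [a]"] by simp
  moreover have "distinct (a # b # c # d # ws @ xs @ rev (v @ u) @ rev ys)" using dis by auto
  ultimately show False
    using E(2) w1 ij kl abcd unfolding crossing_chord_free_def by blast
qed

text \<open>Both orders may be rotated. If there is a common vertex \<open>c\<close>, one order is
  made to end and the other to begin with it, and the two are glued there.\<close>

lemma noncrossing_order_Un:
  assumes p: "distinct p" "set p = X" "noncrossing E p" and q: "distinct q" "set q = Y" "noncrossing E q"
    and c: "X \<inter> Y \<subseteq> {c}" and "sym E" and no: "\<And>x y. x \<in> X - Y \<Longrightarrow> y \<in> Y - X \<Longrightarrow> (x, y) \<notin> E"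
  shows "\<exists>r. distinct r \<and> set r = X \<union> Y \<and> noncrossing E r"
proof (cases "X \<inter> Y = {}")
  case True
  have "noncrossing E (p @ [] @ q)"
    using p q no True assms(8) by (intro noncrossing_glue) auto
  then show ?thesis using p q True by (intro exI[of _ "p @ q"]) auto
next
  case False
  then have c': "X \<inter> Y = {c}" using c by auto
  then have "c \<in> set p" "c \<in> set q" using p q by auto
  then obtain u v s t where p': "p = u @ c # v" and q': "q = s @ c # t"
    by (metis in_set_conv_decomp)
  have vu: "set (v @ u) = X - {c}" and ts: "set (t @ s) = Y - {c}"
    using p q p' q' by auto
  have "noncrossing E ((v @ u) @ [c])"
    using noncrossing_rotate[of E "u @ [c]" v] p(3) assms(8) p' by simp
  moreover have "noncrossing E ([c] @ (t @ s))"
    using noncrossing_rotate[of E s "c # t"] q(3) assms(8) q' by simp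
  moreover have "(x, y) \<notin> E" if "x \<in> set (v @ u)" "y \<in> set (t @ s)" for x y
    using that no c' unfolding vu ts by blast
  ultimately have nc: "noncrossing E ((v @ u) @ [c] @ (t @ s))"
    by (intro noncrossing_glue[of E "v @ u" "[c]" "t @ s"]) (use assms(8) in simp_all)
  have "set (v @ u) \<inter> set (t @ s) = {}" unfolding vu ts using c' by blast
  moreover have "distinct (v @ u)" "distinct (t @ s)" using p(1) q(1) p' q' by auto
  moreover have "c \<notin> set (v @ u)" "c \<notin> set (t @ s)" unfolding vu ts by auto
  ultimately have "distinct ((v @ u) @ [c] @ (t @ s))" by auto
  moreover have "set ((v @ u) @ [c] @ (t @ s)) = insert c (set (v @ u) \<union> set (t @ s))" by auto
  then have "set ((v @ u) @ [c] @ (t @ s)) = X \<union> Y"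
    unfolding vu ts using c' by blast
  ultimately show ?thesis using nc by blast
qed

text \<open>A separation of order at most one: if \<open>X \<inter> Y\<close> is empty, then
  \<open>A\<close> is disconnected, and otherwise \<open>c\<close> is a cut vertex.\<close>

definition separable :: "('a \<times> 'a) set \<Rightarrow> 'a set \<Rightarrow> bool" where
  "separable E A \<longleftrightarrow> (\<exists>X Y c. X \<union> Y = A \<and> X \<noteq> A \<and> Y \<noteq> A \<and> X \<inter> Y \<subseteq> {c} \<and>
      (\<forall>x\<in>X - Y. \<forall>y\<in>Y - X. (x, y) \<notin> E))"

lemma separableI:
  assumes "X \<union> Y = A" "X \<noteq> A" "Y \<noteq> A" "X \<inter> Y \<subseteq> {c}"
    and "\<And>x y. x \<in> X \<Longrightarrow> x \<notin> Y \<Longrightarrow> y \<in> Y \<Longrightarrow> y \<notin> X \<Longrightarrow> (x, y) \<in> E \<Longrightarrow> False"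
  shows "separable E A"
  unfolding separable_def using assms by (intro exI[of _ X] exI[of _ Y] exI[of _ c]) auto

lemma walk_Restr_subset: "walk {(x, y) \<in> E. x \<in> B \<and> y \<in> B} q \<Longrightarrow> 2 \<le> length q \<Longrightarrow> set q \<subseteq> B"
proof (induction q rule: induct_list012)
  case (3 x y zs)
  then show ?case by (cases zs) auto
qed auto

text \<open>\<open>K\<close> is the component of a missing vertex \<open>w\<close> outside
  \<open>S\<close>, and \<open>N\<close> is the set of its attachments in \<open>S\<close>. Were
  \<open>N\<close> contained in a singleton, \<open>K \<union> N\<close> and \<open>A - K\<close>
  would form a separation. Hence there are two attachments, joined by a path through
  \<open>K\<close>.\<close>

lemma ear_exists:
  assumes "\<not> separable E A" "sym E" "S \<subset> A" and S: "\<And>c. \<not> S \<subseteq> {c}"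
  obtains a b q where "a \<in> S" "b \<in> S" "a \<noteq> b" "q \<noteq> []" "distinct q" "walk E q"
    "(a, hd q) \<in> E" "(last q, b) \<in> E" "set q \<subseteq> A - S"
proof -
  define B where "B = A - S"
  obtain w where w: "w \<in> B" using assms(3) by (auto simp: B_def)
  define R where "R = {(x, y) \<in> E. x \<in> B \<and> y \<in> B}"
  define K where "K = {y. (w, y) \<in> R\<^sup>*}"
  define N where "N = {x \<in> S. \<exists>y\<in>K. (x, y) \<in> E}"
  have KB: "K \<subseteq> B"
  proof
    fix y assume "y \<in> K"
    then have "(w, y) \<in> R\<^sup>*" by (simp add: K_def)
    then show "y \<in> B" using w by (induction rule: rtrancl_induct) (auto simp: R_def)
  qed
  have wK: "w \<in> K" by (simp add: K_def)
  have N: "\<not> N \<subseteq> {c}" for c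
  proof
    assume c: "N \<subseteq> {c}"
    have "separable E A"
    proof (rule separableI)
      show "K \<union> N \<union> (A - K) = A" using KB assms(3) by (auto simp: B_def N_def)
      show "K \<union> N \<noteq> A"
      proof
        assume "K \<union> N = A"
        then have "S \<subseteq> N" using KB assms(3) by (auto simp: B_def)
        then show False using S[of c] c by blast
      qed
      show "A - K \<noteq> A" using wK w by (auto simp: B_def)
      show "(K \<union> N) \<inter> (A - K) \<subseteq> {c}" using c by blast
    next
      fix x y
      assume x: "x \<in> K \<union> N" "x \<notin> A - K" and y: "y \<in> A - K" "y \<notin> K \<union> N" and xy: "(x, y) \<in> E"
      have xK: "x \<in> K" using x assms(3) by (auto simp: N_def)
      have "y \<notin> S" using y(2) xK xy assms(2) by (auto simp: N_def dest: symD)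
      then have "(x, y) \<in> R" using xK xy KB y by (auto simp: R_def B_def)
      then have "y \<in> K" using xK by (simp add: K_def)
      then show False using y by blast
    qed
    then show False using assms(1) by simp
  qed
  then obtain s where s: "s \<in> N" by blast
  then obtain t where t: "t \<in> N" "t \<noteq> s" using N[of s] by blast
  obtain x y where x: "x \<in> K" "(s, x) \<in> E" and y: "y \<in> K" "(t, y) \<in> E"
    using s t by (auto simp: N_def)
  have "sym R" using assms(2) by (auto simp: R_def sym_def)
  then have "(x, w) \<in> R\<^sup>*" using x(1) by (simp add: K_def) (metis sym_rtrancl symD)
  moreover have "(w, y) \<in> R\<^sup>*" using y(1) by (simp add: K_def)
  ultimately have "(x, y) \<in> R\<^sup>*" by (rule rtrancl_trans)
  then obtain q where q: "q \<noteq> []" "distinct q" "walk R q" "hd q = x" "last q = y"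
    using rtrancl_distinct_walk by metis
  have qB: "set q \<subseteq> B"
  proof (cases "2 \<le> length q")
    case True
    then show ?thesis using walk_Restr_subset[of E B q] q(3) by (simp add: R_def)
  next
    case False
    then have "q = [x]" using q(1,4) by (cases q) (auto simp: not_less_eq_eq)
    then show ?thesis using x(1) KB by auto
  qed
  have "walk E q" using q(3) by (rule successively_mono) (auto simp: R_def)
  moreover have "(y, t) \<in> E" using y(2) assms(2) by (auto dest: symD)
  ultimately show thesis
    using that[of s t q] s t q x qB by (auto simp: N_def B_def)
qed

text \<open>A longest cycle misses no vertex, because otherwise it has an ear and
  \<open>cycle_list_ear\<close> yields a longer one.\<close>

lemma Hamiltonian_cycle_list_exists:
  assumes "finite A" "\<not> separable E A" "2 \<le> card A" "sym E" "theta_free E"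
  shows "\<exists>p. cycle_list E p \<and> set p = A"
proof -
  obtain a where a: "a \<in> A" using assms(3) by fastforce
  have "{a} \<noteq> A" using assms(3) by auto
  then have "\<exists>b. b \<in> A \<and> b \<noteq> a \<and> (a, b) \<in> E"
    using assms(2) a separableI[of "{a}" "A - {a}" A a E] by blast
  then obtain b where b: "b \<in> A" "b \<noteq> a" "(a, b) \<in> E" by blast
  define C where "C = {p. cycle_list E p \<and> set p \<subseteq> A}"
  have abC: "[a, b] \<in> C" using a b assms(4) by (auto simp: C_def cycle_list_def dest: symD)
  have bd: "length p \<le> card A" if "p \<in> C" for p
    using that assms(1) by (metis (no_types, lifting) C_def card_mono cycle_list_def distinct_card mem_Collect_eq)
  obtain p where p: "p \<in> C" and max: "\<And>q. q \<in> C \<Longrightarrow> length q \<le> length p"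
    using ex_has_greatest_nat[of "\<lambda>p. p \<in> C" "[a, b]" length "Suc (card A)"] abC bd
    by (metis le_imp_less_Suc)
  have cyc: "cycle_list E p" and pA: "set p \<subseteq> A" using p by (auto simp: C_def)
  have nS: "\<not> set p \<subseteq> {c}" for c
  proof
    assume "set p \<subseteq> {c}"
    then have "card (set p) \<le> card {c}" by (intro card_mono) auto
    then show False using cyc by (simp add: cycle_list_def distinct_card)
  qed
  have "set p = A"
  proof (rule ccontr)
    assume "set p \<noteq> A"
    then have psub: "set p \<subset> A" using pA by blast
    obtain a b q where q: "a \<in> set p" "b \<in> set p" "a \<noteq> b" "q \<noteq> []" "distinct q" "walk E q"
      "(a, hd q) \<in> E" "(last q, b) \<in> E" "set q \<subseteq> A - set p"
      using ear_exists[OF assms(2,4) psub nS] .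
    have "set q \<inter> set p = {}" using q(9) by blast
    then obtain p' where p': "cycle_list E p'" "set p' \<subseteq> set p \<union> set q" "length p < length p'"
      using cycle_list_ear[OF cyc q(1-8) _ assms(4,5)] by blast
    have "p' \<in> C" using p' pA q(9) by (auto simp: C_def)
    then show False using max[of p'] p'(3) by simp
  qed
  then show ?thesis using cyc by blast
qed

text \<open>A separation reduces the claim to two smaller sets whose orders are glued; without a
  separation, the cyclic order of a Hamiltonian cycle is noncrossing. Maximality is not assumed
  here, so cut vertices do occur.\<close>

lemma noncrossing_order_exists:
  assumes "finite A" "sym E" "theta_free E" "crossing_chord_free E"
  shows "\<exists>p. distinct p \<and> set p = A \<and> noncrossing E p"
  using assms(1)
proof (induction A rule: finite_psubset_induct)
  case (psubset A)
  consider "separable E A" | "\<not> separable E A" "2 \<le> card A" | "card A \<le> 1" by linarith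
  then show ?case
  proof cases
    case 1
    then obtain X Y c where XY: "X \<union> Y = A" "X \<noteq> A" "Y \<noteq> A" and c: "X \<inter> Y \<subseteq> {c}"
      and no: "\<And>x y. x \<in> X - Y \<Longrightarrow> y \<in> Y - X \<Longrightarrow> (x, y) \<notin> E" unfolding separable_def by blast
    obtain p where p: "distinct p" "set p = X" "noncrossing E p"
      using psubset.IH[of X] XY by blast
    obtain q where q: "distinct q" "set q = Y" "noncrossing E q"
      using psubset.IH[of Y] XY by blast
    show ?thesis using noncrossing_order_Un[OF p q c assms(2) no] XY(1) by simp
  next
    case 2
    then obtain p where "cycle_list E p" "set p = A"
      using Hamiltonian_cycle_list_exists[OF psubset.hyps _ _ assms(2,3)] by blast
    then show ?thesis
      using cycle_list_noncrossing[OF _ assms(2,4)] by (auto simp: cycle_list_def)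
  next
    case 3
    obtain p where p: "set p = A" "distinct p" using psubset.hyps finite_distinct_list by blast
    then have "length p \<le> 1" using 3 by (metis distinct_card)
    then have "noncrossing E p" by (auto simp: noncrossing_def)
    then show ?thesis using p by blast
  qed
qed

section \<open>Drawings with vertices on a parabola\<close>

text \<open>On a strictly convex curve, chords whose ends do not interleave meet at most in common
  ends. In addition no chord passes below the parabola, so the vertical ray below each point is free
  and leads to the outer face.\<close>

definition parabola_point :: "nat \<Rightarrow> complex" where
  "parabola_point i = Complex (real i) ((real i)\<^sup>2)"

lemma inj_parabola_point: "inj parabola_point"
  by (auto simp: inj_def parabola_point_def)

text \<open>Affine functions respect convex combinations. On the parabola,
  \<open>Im z + b * Re z + c\<close> is a monic quadratic polynomial in the abscissa, so
  \<open>b\<close> and \<open>c\<close> can be chosen with the zero set being a prescribed chord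
  line or tangent.\<close>

lemma quadratic_on_segment:
  assumes "z \<in> closed_segment (parabola_point k) (parabola_point l)"
  shows "\<exists>t. 0 \<le> t \<and> t \<le> 1 \<and> z = (1 - t) *\<^sub>R parabola_point k + t *\<^sub>R parabola_point l \<and>
    (\<forall>b c. Im z + b * Re z + c = (1 - t) * ((real k)\<^sup>2 + b * real k + c) + t * ((real l)\<^sup>2 + b * real l + c))"
proof -
  obtain t where t: "0 \<le> t" "t \<le> 1" "z = (1 - t) *\<^sub>R parabola_point k + t *\<^sub>R parabola_point l"
    using assms by (auto simp: in_segment)
  have "Im z + b * Re z + c = (1 - t) * ((real k)\<^sup>2 + b * real k + c) + t * ((real l)\<^sup>2 + b * real l + c)" for b c
    unfolding t(3) by (simp add: parabola_point_def algebra_simps)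
  then show ?thesis using t by blast
qed

text \<open>The affine function vanishing on the line through the points \<open>i\<close> and \<open>j\<close> takes the value
  \<open>(m - i) * (m - j)\<close> at the point \<open>m\<close>.\<close>

lemma chord_equation:
  "(real m)\<^sup>2 + (- real i - real j) * real m + real i * real j = (real m - real i) * (real m - real j)"
  by (simp add: algebra_simps power2_eq_square)

text \<open>\<open>h\<close> is the value at a parabola point of the affine function that vanishes
  on the line through \<open>i\<close> and \<open>j\<close>; it is nonpositive from \<open>i\<close>
  to \<open>j\<close> and nonnegative elsewhere. Since the chords do not interleave,
  \<open>h k\<close> and \<open>h l\<close> do not have opposite signs. Their convex combination
  vanishes at \<open>z\<close>, so both terms do, and \<open>z\<close> is an end point unless the
  chords coincide.\<close>

lemma parabola_chords_Int:
  assumes "i < j" "k < l" "\<not> (i < k \<and> k < j \<and> j < l)" "\<not> (k < i \<and> i < l \<and> l < j)"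
    and "(i, j) \<noteq> (k, l)"
    and z: "z \<in> closed_segment (parabola_point i) (parabola_point j)"
      "z \<in> closed_segment (parabola_point k) (parabola_point l)"
  shows "z \<in> parabola_point ` ({i, j} \<inter> {k, l})"
proof -
  define h where "h m = (real m - real i) * (real m - real j)" for m
  note h = chord_equation[of _ i j, folded h_def]
  obtain s where "Im z + (- real i - real j) * Re z + real i * real j = (1 - s) * h i + s * h j"
    using quadratic_on_segment[OF z(1)] unfolding h[symmetric] by blast
  then have z0: "Im z + (- real i - real j) * Re z + real i * real j = 0" by (simp add: h_def)
  obtain t where t: "0 \<le> t" "t \<le> 1" "z = (1 - t) *\<^sub>R parabola_point k + t *\<^sub>R parabola_point l"
    "Im z + (- real i - real j) * Re z + real i * real j = (1 - t) * h k + t * h l"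
    using quadratic_on_segment[OF z(2)] unfolding h[symmetric] by blast
  have sum: "(1 - t) * h k + t * h l = 0" using t(4) z0 by simp
  have "(0 \<le> h k \<and> 0 \<le> h l) \<or> (h k \<le> 0 \<and> h l \<le> 0)"
  proof (cases "i \<le> k \<and> l \<le> j")
    case True
    then have "h k \<le> 0" "h l \<le> 0" using assms(2) by (auto simp: h_def mult_le_0_iff)
    then show ?thesis by simp
  next
    case False
    then have "k \<le> i \<or> j \<le> k" "l \<le> i \<or> j \<le> l" using assms(1-4) by linarith+
    then have "0 \<le> h k" "0 \<le> h l" using assms(1) by (auto simp: h_def zero_le_mult_iff)
    then show ?thesis by simp
  qed
  then have "(0 \<le> (1 - t) * h k \<and> 0 \<le> t * h l) \<or> ((1 - t) * h k \<le> 0 \<and> t * h l \<le> 0)"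
    using t(1,2) by (auto simp: mult_le_0_iff zero_le_mult_iff)
  then have 0: "(1 - t) * h k = 0" "t * h l = 0" using sum by linarith+
  have h0: "m = i \<or> m = j" if "h m = 0" for m using that by (auto simp: h_def)
  consider "t = 0" | "t = 1" | "h k = 0" "h l = 0" using 0 by auto
  then show ?thesis
  proof cases
    case 1
    then have "z = parabola_point k" "k = i \<or> k = j" using t(3) 0 h0 by auto
    then show ?thesis by auto
  next
    case 2
    then have "z = parabola_point l" "l = i \<or> l = j" using t(3) 0 h0 by auto
    then show ?thesis by auto
  next
    case 3
    then have "(i, j) = (k, l)" using h0[of k] h0[of l] assms(1,2) by auto
    then show ?thesis using assms(5) by simp
  qed
qed

lemma parabola_point_in_chord:
  assumes "parabola_point m \<in> closed_segment (parabola_point i) (parabola_point j)"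
  shows "m = i \<or> m = j"
proof -
  obtain t where "Im (parabola_point m) + (- real i - real j) * Re (parabola_point m) + real i * real j =
      (1 - t) * ((real i)\<^sup>2 + (- real i - real j) * real i + real i * real j)
      + t * ((real j)\<^sup>2 + (- real i - real j) * real j + real i * real j)"
    using quadratic_on_segment[OF assms] by blast
  then have "Im (parabola_point m) + (- real i - real j) * Re (parabola_point m) + real i * real j = 0"
    unfolding chord_equation by simp
  then have "(real m - real i) * (real m - real j) = 0"
    unfolding parabola_point_def complex.sel chord_equation .
  then show ?thesis by auto
qed

text \<open>The tangent at the point \<open>m\<close> bounds every chord from below.\<close>

lemma below_parabola_notin_chord:
  assumes "0 < s"
  shows "Complex (real m) ((real m)\<^sup>2 - s) \<notin> closed_segment (parabola_point i) (parabola_point j)"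
proof
  let ?z = "Complex (real m) ((real m)\<^sup>2 - s)"
  assume z: "?z \<in> closed_segment (parabola_point i) (parabola_point j)"
  obtain t where t: "0 \<le> t" "t \<le> 1" "Im ?z + (- 2 * real m) * Re ?z + (real m)\<^sup>2 =
      (1 - t) * ((real i)\<^sup>2 + (- 2 * real m) * real i + (real m)\<^sup>2)
      + t * ((real j)\<^sup>2 + (- 2 * real m) * real j + (real m)\<^sup>2)"
    using quadratic_on_segment[OF z] by blast
  have sq: "(real i)\<^sup>2 + (- 2 * real m) * real i + (real m)\<^sup>2 = (real i - real m)\<^sup>2" for i
    by (simp add: power2_eq_square algebra_simps)
  have "0 \<le> (1 - t) * (real i - real m)\<^sup>2 + t * (real j - real m)\<^sup>2" using t(1,2) by simp
  moreover have "Im ?z + (- 2 * real m) * Re ?z + (real m)\<^sup>2 = - s"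
    by (simp add: power2_eq_square algebra_simps)
  ultimately show False using t(3) assms unfolding sq by linarith
qed

text \<open>The open vertical ray below the point is connected, unbounded and disjoint from
  \<open>D\<close>, so it belongs to the outside; the point is its limit and lies in
  \<open>D\<close>.\<close>

lemma parabola_point_in_frontier:
  assumes D: "parabola_point m \<in> D"
    and below: "\<And>s. 0 < s \<Longrightarrow> Complex (real m) ((real m)\<^sup>2 - s) \<notin> D"
  shows "parabola_point m \<in> frontier (outside D)"
proof -
  define ray where "ray = (\<lambda>s. Complex (real m) ((real m)\<^sup>2 - s)) ` {0<..}"
  have cont: "continuous_on UNIV (\<lambda>s. Complex (real m) ((real m)\<^sup>2 - s))"
    unfolding Complex_eq by (intro continuous_intros)
  have "connected ray"
    unfolding ray_def using continuous_on_subset[OF cont] by (intro connected_continuous_image) auto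
  moreover have "ray \<subseteq> - D" using below by (auto simp: ray_def)
  moreover have "\<not> bounded ray"
  proof
    assume "bounded ray"
    then obtain B where B: "\<And>z. z \<in> ray \<Longrightarrow> norm z \<le> B" by (auto simp: bounded_iff)
    \<comment> \<open>Chosen such that the point of the ray at depth \<open>s\<close> has imaginary
      part \<open>- \<bar>B\<bar> - 1\<close>, which exceeds the bound \<open>B\<close> in absolute
      value.\<close>
    define s where "s = (real m)\<^sup>2 + \<bar>B\<bar> + 1"
    have "0 < s" by (simp add: s_def add_nonneg_pos)
    then have "Complex (real m) ((real m)\<^sup>2 - s) \<in> ray" unfolding ray_def by (intro imageI) simp
    then have "norm (Complex (real m) ((real m)\<^sup>2 - s)) \<le> B" by (rule B)
    moreover have "Im (Complex (real m) ((real m)\<^sup>2 - s)) = - \<bar>B\<bar> - 1" by (simp add: s_def)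
    ultimately show False using abs_Im_le_cmod[of "Complex (real m) ((real m)\<^sup>2 - s)"] by linarith
  qed
  ultimately have "\<not> bounded (connected_component_set (- D) z)" if "z \<in> ray" for z
    using connected_component_maximal[OF that] bounded_subset by metis
  then have "ray \<subseteq> outside D" unfolding outside by blast
  moreover have "parabola_point m \<in> closure ray"
  proof -
    have "((\<lambda>s. Complex (real m) ((real m)\<^sup>2 - s)) \<longlongrightarrow> Complex (real m) ((real m)\<^sup>2 - 0)) (at 0)"
      using bspec[OF cont[unfolded continuous_on_def] UNIV_I[of 0]] .
    then have lim: "((\<lambda>s. Complex (real m) ((real m)\<^sup>2 - s)) \<longlongrightarrow> Complex (real m) ((real m)\<^sup>2 - 0)) (at_right 0)"
      by (rule tendsto_within_subset) simp
    have "Complex (real m) ((real m)\<^sup>2 - s) \<in> closure ray" if "0 < s" for s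
      using that closure_subset[of ray] by (auto simp: ray_def)
    then have ev: "\<forall>\<^sub>F s in at_right (0::real). Complex (real m) ((real m)\<^sup>2 - s) \<in> closure ray"
      by (simp add: eventually_at_right_less eventually_mono[OF eventually_at_right_less[of "0::real"]])
    have "Complex (real m) ((real m)\<^sup>2 - 0) \<in> closure ray"
      by (rule Lim_in_closed_set[OF closed_closure ev trivial_limit_at_right_real lim])
    then show ?thesis by (simp add: parabola_point_def)
  qed
  ultimately have "parabola_point m \<in> closure (outside D)" using closure_mono by blast
  moreover have "parabola_point m \<notin> interior (outside D)"
    using D interior_subset[of "outside D"] outside_no_overlap[of D] by blast
  ultimately show ?thesis by (simp add: frontier_def)
qed

lemma noncrossing_imp_outerplanar:
  assumes p: "distinct p" "set p = pverts G" "noncrossing (parcs G) p" and "sym (parcs G)"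
    and arcs: "\<And>u v. (u, v) \<in> parcs G \<Longrightarrow> u \<in> pverts G \<and> v \<in> pverts G \<and> u \<noteq> v"
  shows "outerplanar G"
proof -
  have "\<forall>v\<in>pverts G. \<exists>i<length p. p ! i = v" using p(2) by (metis in_set_conv_nth)
  then obtain f where f: "\<And>v. v \<in> pverts G \<Longrightarrow> f v < length p" "\<And>v. v \<in> pverts G \<Longrightarrow> p ! f v = v"
    by metis
  have inj_f: "inj_on f (pverts G)" using f(2) by (metis inj_onI)
  define \<phi> where "\<phi> v = parabola_point (f v)" for v
  \<comment> \<open>The convex hull of the two end points is the segment between them, written as a
    function of the unordered edge.\<close>
  define \<gamma> where "\<gamma> e = convex hull (\<phi> ` e)" for e
  have \<gamma>: "\<gamma> {u, v} = closed_segment (\<phi> u) (\<phi> v)" for u v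
    by (simp add: \<gamma>_def segment_convex_hull)
  have inj: "inj_on \<phi> (pverts G)"
    using comp_inj_on[OF inj_f inj_on_subset[OF inj_parabola_point subset_UNIV]] unfolding \<phi>_def[abs_def] comp_def .
  have edge: "\<exists>u v. (u, v) \<in> parcs G \<and> e = {u, v} \<and> f u < f v" if e: "e \<in> edges G" for e
  proof -
    obtain u v where uv: "(u, v) \<in> parcs G" "e = {u, v}" using e unfolding edges_def by blast
    then have "f u \<noteq> f v" using arcs[OF uv(1)] inj_on_eq_iff[OF inj_f, of u v] by simp
    moreover have "(v, u) \<in> parcs G" "e = {v, u}" using uv symD[OF assms(4)] by (auto simp: insert_commute)
    moreover have "f u < f v \<or> f v < f u" if "f u \<noteq> f v" using that by linarith
    ultimately show ?thesis using uv by blast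
  qed
  have int: "\<gamma> e \<inter> \<gamma> e' = \<phi> ` (e \<inter> e')" if e: "e \<in> edges G" "e' \<in> edges G" "e \<noteq> e'" for e e'
  proof
    obtain u v where uv: "(u, v) \<in> parcs G" "e = {u, v}" "f u < f v" using edge[OF e(1)] by blast
    obtain x y where xy: "(x, y) \<in> parcs G" "e' = {x, y}" "f x < f y" using edge[OF e(2)] by blast
    have V: "u \<in> pverts G" "v \<in> pverts G" "x \<in> pverts G" "y \<in> pverts G"
      using arcs uv xy by auto
    have ne: "(f u, f v) \<noteq> (f x, f y)" using e(3) uv(2) xy(2) V inj_on_eq_iff[OF inj_f] by auto
    have nc: "\<not> (f u < f x \<and> f x < f v \<and> f v < f y)" "\<not> (f x < f u \<and> f u < f y \<and> f y < f v)"
      using noncrossingD[OF p(3), of "f u" "f x" "f v" "f y"] noncrossingD[OF p(3), of "f x" "f u" "f y" "f v"]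
        f V uv(1) xy(1) by auto
    show "\<gamma> e \<inter> \<gamma> e' \<subseteq> \<phi> ` (e \<inter> e')"
    proof
      fix z assume "z \<in> \<gamma> e \<inter> \<gamma> e'"
      then have "z \<in> parabola_point ` ({f u, f v} \<inter> {f x, f y})"
        using parabola_chords_Int[OF uv(3) xy(3) nc ne] by (simp add: uv(2) xy(2) \<gamma> \<phi>_def)
      then obtain m where m: "m \<in> {f u, f v}" "m \<in> {f x, f y}" "z = parabola_point m" by blast
      then have "p ! m \<in> e \<inter> e'" "z = \<phi> (p ! m)"
        using f(2) V by (auto simp: uv(2) xy(2) \<phi>_def)
      then show "z \<in> \<phi> ` (e \<inter> e')" by blast
    qed
    show "\<phi> ` (e \<inter> e') \<subseteq> \<gamma> e \<inter> \<gamma> e'" by (auto simp: \<gamma>_def hull_inc)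
  qed
  have arc: "\<exists>g. arc g \<and> pathstart g = \<phi> u \<and> pathfinish g = \<phi> v \<and>
      path_image g = \<gamma> {u, v} \<and> path_image g \<inter> \<phi> ` pverts G = {\<phi> u, \<phi> v}"
    if uv: "(u, v) \<in> parcs G" for u v
  proof (intro exI conjI)
    have V: "u \<in> pverts G" "v \<in> pverts G" "u \<noteq> v" using arcs[OF uv] by auto
    show "arc (linepath (\<phi> u) (\<phi> v))" using V inj_on_eq_iff[OF inj] by (simp add: arc_linepath)
    show "path_image (linepath (\<phi> u) (\<phi> v)) \<inter> \<phi> ` pverts G = {\<phi> u, \<phi> v}"
    proof
      show "path_image (linepath (\<phi> u) (\<phi> v)) \<inter> \<phi> ` pverts G \<subseteq> {\<phi> u, \<phi> v}"
        unfolding \<phi>_def using parabola_point_in_chord by fastforce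
    qed (use V in auto)
  qed (simp_all add: \<gamma>)
  have "plane_embedding G \<phi> \<gamma>"
    unfolding plane_embedding_def using inj int arc by auto
  moreover have "\<phi> ` pverts G \<subseteq> frontier (outside (drawing G \<phi> \<gamma>))"
  proof (intro image_subsetI)
    fix v assume v: "v \<in> pverts G"
    show "\<phi> v \<in> frontier (outside (drawing G \<phi> \<gamma>))"
      unfolding \<phi>_def[of v]
    proof (rule parabola_point_in_frontier)
      show "parabola_point (f v) \<in> drawing G \<phi> \<gamma>" using v by (auto simp: drawing_def \<phi>_def)
      fix s :: real assume s: "0 < s"
      let ?z = "Complex (real (f v)) ((real (f v))\<^sup>2 - s)"
      have "?z \<noteq> \<phi> u" for u
        using below_parabola_notin_chord[OF s, of "f v" "f u" "f u"] by (auto simp: \<phi>_def)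
      moreover have "?z \<notin> \<gamma> e" if "e \<in> edges G" for e
        using edge[OF that] below_parabola_notin_chord[OF s, of "f v"] by (auto simp: \<gamma> \<phi>_def)
      ultimately show "?z \<notin> drawing G \<phi> \<gamma>" by (auto simp: drawing_def)
    qed
  qed
  ultimately show ?thesis unfolding outerplanar_def by blast
qed

section \<open>Iterated addition of vertices\<close>

text \<open>The arc set stays fixed while the vertex set grows. The minimum lets the construction
  start from nothing: as long as at most \<open>k\<close> vertices are present, a new one is joined
  to all of them, so the first \<open>k + 1\<close> vertices form a clique.\<close>

inductive k_built :: "nat \<Rightarrow> ('a \<times> 'a) set \<Rightarrow> 'a set \<Rightarrow> bool" for k E where
  empty: "k_built k E {}"
| add: "k_built k E A \<Longrightarrow> w \<notin> A \<Longrightarrow> S \<subseteq> A \<Longrightarrow> min k (card A) \<le> card S \<Longrightarrow>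
    (\<And>s. s \<in> S \<Longrightarrow> (s, w) \<in> E) \<Longrightarrow> k_built k E (insert w A)"

lemma k_built_mono: "k_built k E A \<Longrightarrow> E \<subseteq> E' \<Longrightarrow> k_built k E' A"
proof (induction rule: k_built.induct)
  case (add A w S)
  then show ?case by (intro k_built.add[of k E' A w S]) auto
qed (rule k_built.empty)

lemma k_built_clique:
  assumes "finite A" "\<And>x y. x \<in> A \<Longrightarrow> y \<in> A \<Longrightarrow> x \<noteq> y \<Longrightarrow> (x, y) \<in> E"
  shows "k_built k E A"
  using assms
proof (induction A rule: finite_induct)
  case (insert w A)
  then show ?case by (intro k_built.add[of k E A w A]) auto
qed (rule k_built.empty)

lemma k_built_finite: "k_built k E A \<Longrightarrow> finite A"
  by (induction rule: k_built.induct) auto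

section \<open>Expansion of neighbourhoods and growth of balls\<close>

definition nbhd :: "('a \<times> 'a) set \<Rightarrow> 'a set \<Rightarrow> 'a set \<Rightarrow> 'a set" where
  "nbhd E A X = X \<union> {y \<in> A. \<exists>x\<in>X. (x, y) \<in> E}"

text \<open>This expansion property amounts to \<open>k\<close>-connectedness.\<close>

lemma k_built_expansion:
  assumes "k_built k E A" "sym E" "X \<subseteq> A" "X \<noteq> {}"
  shows "min (card A) (card X + k) \<le> card (nbhd E A X)"
  using assms
proof (induction arbitrary: X rule: k_built.induct)
  case (add A w S)
  have fin: "finite A" using k_built_finite add.hyps(1) .
  have cA: "card (insert w A) = Suc (card A)" using fin add.hyps(2) by simp
  have finN: "finite (nbhd E (insert w A) X)"
    using fin add.prems(2) by (auto simp: nbhd_def intro: finite_subset)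
  show ?case
  proof (cases "w \<in> X")
    case False
    then have X: "X \<subseteq> A" using add.prems by blast
    then have finX: "finite X" using fin finite_subset by blast
    have IH: "min (card A) (card X + k) \<le> card (nbhd E A X)" using add.IH[OF add.prems(1) X add.prems(3)] .
    have sub: "nbhd E A X \<subseteq> nbhd E (insert w A) X" by (auto simp: nbhd_def)
    show ?thesis
    proof (cases "card X + k \<le> card A")
      case True
      then show ?thesis using IH card_mono[OF finN sub] by simp
    next
      case False
      have "finite S" using fin add.hyps(3) finite_subset by blast
      \<comment> \<open>Here the induction hypothesis already fills all of \<open>A\<close>, so the
        new vertex \<open>w\<close> must be reached as well. If \<open>X\<close> and
        \<open>S\<close> were disjoint, \<open>card X + card S\<close> would be at most
        \<open>card A\<close>, against \<open>card X + k > card A\<close> and the lower bound on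
        \<open>card S\<close>.\<close>
      have "X \<inter> S \<noteq> {}"
      proof
        assume "X \<inter> S = {}"
        then have "card X + card S = card (X \<union> S)"
          using finX \<open>finite S\<close> by (simp add: card_Un_disjoint)
        also have "\<dots> \<le> card A" using X add.hyps(3) fin by (simp add: card_mono)
        finally have "card X + card S \<le> card A" .
        moreover have "0 < card X" using finX add.prems(3) by (simp add: card_gt_0_iff)
        ultimately show False using False add.hyps(4) by linarith
      qed
      then have "w \<in> nbhd E (insert w A) X" using add.hyps(5) by (auto simp: nbhd_def)
      then have "card (insert w (nbhd E A X)) \<le> card (nbhd E (insert w A) X)"
        using finN sub by (intro card_mono) auto
      moreover have "card A \<le> card (nbhd E A X)" using IH False by simp
      moreover have "w \<notin> nbhd E A X" using add.hyps(2) X by (auto simp: nbhd_def)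
      moreover have "finite (nbhd E A X)" using finN sub finite_subset by blast
      ultimately show ?thesis using cA by simp
    qed
  next
    case True
    show ?thesis
    proof (cases "X = {w}")
      case True
      have "insert w S \<subseteq> nbhd E (insert w A) X"
        using add.hyps(3,5) add.prems(1) True by (auto simp: nbhd_def dest: symD)
      then have "card (insert w S) \<le> card (nbhd E (insert w A) X)" using finN card_mono by blast
      moreover have "w \<notin> S" "finite S" using add.hyps(2,3) fin finite_subset by auto
      ultimately show ?thesis using add.hyps(4) cA True by simp
    next
      case False
      \<comment> \<open>Removing \<open>w\<close> lowers \<open>card X\<close> by one, and
        \<open>w\<close> itself makes up for it in the neighbourhood.\<close>
      define Y where "Y = X - {w}"
      have Y: "Y \<subseteq> A" "Y \<noteq> {}" using add.prems False \<open>w \<in> X\<close> by (auto simp: Y_def)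
      have IH: "min (card A) (card Y + k) \<le> card (nbhd E A Y)" using add.IH[OF add.prems(1) Y] .
      have "finite X" using add.prems(2) fin finite_subset by (metis finite_insert)
      then have "card X = Suc (card Y)" using \<open>w \<in> X\<close> unfolding Y_def by (metis card_Suc_Diff1)
      moreover have "insert w (nbhd E A Y) \<subseteq> nbhd E (insert w A) X"
        using \<open>w \<in> X\<close> by (auto simp: nbhd_def Y_def)
      then have "card (insert w (nbhd E A Y)) \<le> card (nbhd E (insert w A) X)" using finN card_mono by blast
      moreover have "w \<notin> nbhd E A Y" using add.hyps(2) Y by (auto simp: nbhd_def)
      moreover have "finite (nbhd E A Y)"
        using fin Y(1) by (auto simp: nbhd_def intro: finite_subset)
      ultimately show ?thesis using IH cA by simp
    qed
  qed
qed auto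

text \<open>Distances are measured inside \<open>A\<close>, that is, at one stage of the
  construction; balls only grow when \<open>A\<close> does.\<close>

definition ball_of :: "('a \<times> 'a) set \<Rightarrow> 'a set \<Rightarrow> nat \<Rightarrow> 'a \<Rightarrow> 'a set" where
  "ball_of E A d u = (nbhd E A ^^ d) {u}"

lemma ball_of_0: "ball_of E A 0 u = {u}"
  by (simp add: ball_of_def)

lemma ball_of_Suc: "ball_of E A (Suc d) u = nbhd E A (ball_of E A d u)"
  by (simp add: ball_of_def)

lemma center_in_ball_of: "u \<in> ball_of E A d u"
  by (induction d) (auto simp: ball_of_0 ball_of_Suc nbhd_def)

lemma ball_of_subset: "u \<in> A \<Longrightarrow> ball_of E A d u \<subseteq> A"
  by (induction d) (auto simp: ball_of_0 ball_of_Suc nbhd_def)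

lemma ball_of_mono: "A \<subseteq> B \<Longrightarrow> ball_of E A d u \<subseteq> ball_of E B d u"
proof (induction d)
  case (Suc d)
  then show ?case unfolding ball_of_Suc nbhd_def by blast
qed (simp add: ball_of_0)

lemma ball_of_relpow: "v \<in> ball_of E A d u \<Longrightarrow> \<exists>m\<le>d. (u, v) \<in> E ^^ m"
proof (induction d arbitrary: v)
  case (Suc d)
  then consider "v \<in> ball_of E A d u" | x where "x \<in> ball_of E A d u" "(x, v) \<in> E"
    by (auto simp: ball_of_Suc nbhd_def)
  then show ?case
  proof cases
    case 1
    then show ?thesis using Suc.IH by (meson le_SucI)
  next
    case 2
    then obtain m where "m \<le> d" "(u, x) \<in> E ^^ m" using Suc.IH by blast
    then show ?thesis using 2(2) by (intro exI[of _ "Suc m"]) auto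
  qed
qed (auto simp: ball_of_0)

lemma card_ball_of:
  assumes "k_built k E A" "sym E" "u \<in> A"
  shows "min (card A) (Suc (k * d)) \<le> card (ball_of E A d u)"
proof (induction d)
  case 0
  then show ?case by (simp add: ball_of_0)
next
  case (Suc d)
  have "min (card A) (card (ball_of E A d u) + k) \<le> card (ball_of E A (Suc d) u)"
    unfolding ball_of_Suc using center_in_ball_of[of u E A d]
    by (intro k_built_expansion[OF assms(1,2) ball_of_subset[OF assms(3)]]) auto
  then show ?case using Suc by auto
qed

lemma k_built_reachable:
  assumes "k_built k E A" "sym E" "0 < k" "u \<in> A" "v \<in> A"
  shows "\<exists>m. (u, v) \<in> E ^^ m"
proof -
  \<comment> \<open>Since \<open>k\<close> is positive, a ball of radius \<open>card A\<close> is
    large enough to be all of \<open>A\<close>.\<close>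
  have "card A \<le> Suc (k * card A)" using assms(3) by (cases k) auto
  then have "card A \<le> card (ball_of E A (card A) u)"
    using card_ball_of[OF assms(1,2,4), of "card A"] by simp
  then have "ball_of E A (card A) u = A"
    by (rule card_seteq[OF k_built_finite[OF assms(1)] ball_of_subset[OF assms(4)]])
  then have "v \<in> ball_of E A (card A) u" using assms(5) by simp
  from ball_of_relpow[OF this] show ?thesis by blast
qed

definition close_pairs :: "('a \<times> 'a) set \<Rightarrow> 'a set \<Rightarrow> nat \<Rightarrow> 'a set set" where
  "close_pairs E A d = {{u, v} |u v. u \<in> A \<and> v \<in> A \<and> u \<noteq> v \<and> v \<in> ball_of E A d u}"

lemma close_pairs_subset: "close_pairs E A d \<subseteq> Pow A"
  by (auto simp: close_pairs_def)

text \<open>A pair is counted at the stage that adds its later vertex, so different stages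
  contribute disjoint sets. Leaving out the centre \<open>w\<close> of the ball turns
  \<open>min (Suc (card A)) (Suc (k * d))\<close> into \<open>min (card A) (k * d)\<close>. Pairs
  from earlier stages stay close by \<open>ball_of_mono\<close>.\<close>

lemma card_close_pairs:
  assumes "k_built k E A" "sym E"
  shows "(\<Sum>m<card A. min m (k * d)) \<le> card (close_pairs E A d)"
  using assms
proof (induction rule: k_built.induct)
  case (add A w S)
  let ?B = "insert w A"
  have fin: "finite A" using k_built_finite add.hyps(1) .
  have B: "k_built k E ?B" using k_built.add[OF add.hyps] .
  let ?N = "(\<lambda>x. {w, x}) ` (ball_of E ?B d w - {w})"
  have sub: "ball_of E ?B d w \<subseteq> ?B" by (rule ball_of_subset) simp
  then have finb: "finite (ball_of E ?B d w)" using fin finite_subset by blast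
  have "inj_on (\<lambda>x. {w, x}) (ball_of E ?B d w - {w})"
    by (auto simp: inj_on_def doubleton_eq_iff)
  then have "card ?N = card (ball_of E ?B d w) - 1"
    by (simp add: card_image card_Diff_singleton[OF center_in_ball_of])
  moreover have "min (Suc (card A)) (Suc (k * d)) \<le> card (ball_of E ?B d w)"
    using card_ball_of[OF B add.prems, of w d] fin add.hyps(2) by simp
  ultimately have N: "min (card A) (k * d) \<le> card ?N" by linarith
  have fins: "finite (close_pairs E A d)" "finite ?N"
    using fin finb finite_subset[OF close_pairs_subset] by auto
  have "close_pairs E A d \<inter> ?N = {}"
    using close_pairs_subset[of E A d] add.hyps(2) by blast
  then have "card (close_pairs E A d) + card ?N = card (close_pairs E A d \<union> ?N)"
    using fins by (simp add: card_Un_disjoint)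
  also have "\<dots> \<le> card (close_pairs E ?B d)"
  proof (rule card_mono)
    show "finite (close_pairs E ?B d)"
      using fin finite_subset[OF close_pairs_subset] by (metis finite_Pow_iff finite_insert)
    show "close_pairs E A d \<union> ?N \<subseteq> close_pairs E ?B d"
      using ball_of_mono[of A ?B E d] sub unfolding close_pairs_def by blast
  qed
  finally show ?case using add.IH[OF add.prems] N fin add.hyps(2) by simp
qed simp

section \<open>Maximal outerplanar graphs\<close>

definition crosses :: "('a \<times> 'a) set \<Rightarrow> 'a list \<Rightarrow> nat \<Rightarrow> nat \<Rightarrow> bool" where
  "crosses E p i j \<longleftrightarrow> (\<exists>k l. k < l \<and> l < length p \<and> (p ! k, p ! l) \<in> E \<and>
     ((i < k \<and> k < j \<and> j < l) \<or> (k < i \<and> i < l \<and> l < j)))"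

text \<open>A triangulated convex polygon in combinatorial form. Its sides join consecutive
  positions, and the first to the last; they cross nothing and are therefore edges.\<close>

definition maximal_noncrossing :: "('a \<times> 'a) set \<Rightarrow> 'a list \<Rightarrow> bool" where
  "maximal_noncrossing E p \<longleftrightarrow> noncrossing E p \<and>
     (\<forall>i j. i < j \<and> j < length p \<and> \<not> crosses E p i j \<longrightarrow> (p ! i, p ! j) \<in> E)"

lemma noncrossing_add_edge:
  assumes "distinct p" "noncrossing E p" "i < j" "j < length p" "\<not> crosses E p i j"
  shows "noncrossing (E \<union> {(p ! i, p ! j), (p ! j, p ! i)}) p"
  unfolding noncrossing_def
proof (intro allI impI notI)
  fix a b c d
  assume *: "a < b \<and> b < c \<and> c < d \<and> d < length p"
  assume "(p ! a, p ! c) \<in> E \<union> {(p ! i, p ! j), (p ! j, p ! i)}"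
    and "(p ! b, p ! d) \<in> E \<union> {(p ! i, p ! j), (p ! j, p ! i)}"
  then have "(p ! a, p ! c) \<in> E \<or> (a = i \<and> c = j)" "(p ! b, p ! d) \<in> E \<or> (b = i \<and> d = j)"
    using * assms(1,3,4) by (auto simp: nth_eq_iff_index_eq)
  moreover have "\<not> ((p ! a, p ! c) \<in> E \<and> (p ! b, p ! d) \<in> E)"
    using assms(2) * unfolding noncrossing_def by blast
  moreover have "\<not> ((p ! a, p ! c) \<in> E \<and> b = i \<and> d = j)"
    using assms(5) * unfolding crosses_def by (metis order.strict_trans)
  moreover have "\<not> (a = i \<and> c = j \<and> (p ! b, p ! d) \<in> E)"
    using assms(5) * unfolding crosses_def by (metis order.strict_trans)
  ultimately show False using * by auto
qed

text \<open>The apex \<open>k\<close> is the last neighbour of \<open>i\<close> before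
  \<open>j\<close>. An edge that crosses the pair \<open>k\<close>, \<open>j\<close> would cross the
  edge from \<open>i\<close> to \<open>j\<close> or the edge from \<open>i\<close> to
  \<open>k\<close>, or lead from \<open>i\<close> to a later neighbour before \<open>j\<close>. So
  nothing crosses this pair, and maximality makes it an edge.\<close>

lemma maximal_noncrossing_triangle:
  assumes "maximal_noncrossing E p" "sym E" "Suc i < j" "j < length p" "(p ! i, p ! j) \<in> E"
  shows "\<exists>k. i < k \<and> k < j \<and> (p ! i, p ! k) \<in> E \<and> (p ! k, p ! j) \<in> E"
proof -
  define K where "K = {k. i < k \<and> k < j \<and> (p ! i, p ! k) \<in> E}"
  have nc: "noncrossing E p" using assms(1) by (simp add: maximal_noncrossing_def)
  have mx: "(p ! i, p ! j) \<in> E" if "i < j" "j < length p" "\<not> crosses E p i j" for i j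
    using that assms(1) by (simp add: maximal_noncrossing_def)
  have "\<not> crosses E p i (Suc i)" by (auto simp: crosses_def)
  then have "Suc i \<in> K" using mx[of i "Suc i"] assms(3,4) by (simp add: K_def)
  moreover have fin: "finite K" by (simp add: K_def)
  ultimately have "Max K \<in> K" by (intro Max_in) auto
  then obtain k where k: "k = Max K" "i < k" "k < j" "(p ! i, p ! k) \<in> E" by (auto simp: K_def)
  have "\<not> crosses E p k j"
  proof
    assume "crosses E p k j"
    then obtain a b where ab: "a < b" "b < length p" "(p ! a, p ! b) \<in> E"
      "(k < a \<and> a < j \<and> j < b) \<or> (a < k \<and> k < b \<and> b < j)" unfolding crosses_def by blast
    from ab(4) show False
    proof
      assume "k < a \<and> a < j \<and> j < b"
      then show False using noncrossingD[OF nc, of i a j b] k(2) ab assms(5) by simp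
    next
      assume *: "a < k \<and> k < b \<and> b < j"
      consider "a < i" | "a = i" | "i < a" by linarith
      then show False
      proof cases
        case 1
        then show False using noncrossingD[OF nc, of a i b j] * k(2) ab assms(4,5) by simp
      next
        case 2
        then have "b \<in> K" using * ab k(2) by (simp add: K_def)
        then show False using Max_ge[OF fin] * k(1) by fastforce
      next
        case 3
        then show False using noncrossingD[OF nc, of i a k b] * k(4) ab by simp
      qed
    qed
  qed
  then have "(p ! k, p ! j) \<in> E" using mx[of k j] k(3) assms(4) by simp
  then show ?thesis using k by blast
qed

text \<open>The apex of the triangle on \<open>i\<close> and \<open>j\<close> is joined to two
  vertices that are already present; then the two shorter intervals are filled. The set
  \<open>A\<close> is arbitrary in the induction because the second interval is built on top of the
  first.\<close>

lemma k_built_interval: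
  assumes "maximal_noncrossing E p" "sym E" "distinct p"
    and "i < j" "j < length p" "(p ! i, p ! j) \<in> E" "k_built 2 E A" "p ! i \<in> A" "p ! j \<in> A"
    and "A \<inter> (!) p ` {i<..<j} = {}"
  shows "k_built 2 E (A \<union> (!) p ` {i..j})"
  using assms(4-)
proof (induction "j - i" arbitrary: i j A rule: less_induct)
  case less
  show ?case
  proof (cases "Suc i < j")
    case False
    then have "{i..j} = {i, j}" using less.prems(1) by auto
    then have "A \<union> (!) p ` {i..j} = A" using less.prems by auto
    then show ?thesis using less.prems by simp
  next
    case True
    obtain k where k: "i < k" "k < j" "(p ! i, p ! k) \<in> E" "(p ! k, p ! j) \<in> E"
      using maximal_noncrossing_triangle[OF assms(1,2) True] less.prems by blast
    let ?B = "insert (p ! k) A"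
    have inj: "p ! a = p ! b \<longleftrightarrow> a = b" if "a \<le> j" "b \<le> j" for a b
      using that less.prems(2) assms(3) by (simp add: nth_eq_iff_index_eq)
    have "p ! k \<notin> A" using less.prems(7) k by auto
    moreover have "card {p ! i, p ! j} = 2" using inj[of i j] less.prems(1) by simp
    moreover have "(p ! j, p ! k) \<in> E" using k(4) assms(2) by (auto dest: symD)
    ultimately have B: "k_built 2 E ?B"
      using less.prems k(3) by (intro k_built.add[of 2 E A _ "{p ! i, p ! j}"]) auto
    have "?B \<inter> (!) p ` {i<..<k} = {}"
      using less.prems(7) k inj by (auto simp: disjoint_iff)
    then have C: "k_built 2 E (?B \<union> (!) p ` {i..k})"
      using less.hyps[of k i ?B] B k less.prems by auto
    have "(?B \<union> (!) p ` {i..k}) \<inter> (!) p ` {k<..<j} = {}"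
      using less.prems(7) k inj by (auto simp: disjoint_iff)
    then have "k_built 2 E (?B \<union> (!) p ` {i..k} \<union> (!) p ` {k..j})"
      using less.hyps[of j k "?B \<union> (!) p ` {i..k}"] C k less.prems by auto
    moreover have "?B \<union> (!) p ` {i..k} \<union> (!) p ` {k..j} = A \<union> (!) p ` {i..j}"
    proof -
      have "(!) p ` {i..k} \<union> (!) p ` {k..j} = (!) p ` {i..j}"
        using ivl_disj_un_two_touch(4)[of i k j] k by (simp flip: image_Un)
      moreover have "p ! k \<in> (!) p ` {i..j}" using k by simp
      ultimately show ?thesis by blast
    qed
    ultimately show ?thesis by simp
  qed
qed

lemma maximal_noncrossing_k_built:
  assumes "maximal_noncrossing E p" "sym E" "distinct p" "2 \<le> length p"
  shows "k_built 2 E (set p)"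
proof -
  let ?n = "length p - 1"
  have n: "0 < ?n" "?n < length p" using assms(4) by auto
  \<comment> \<open>A crossing edge would need an end beyond the first or the last position, so
    maximality supplies this starting edge.\<close>
  have "\<not> crosses E p 0 ?n" by (auto simp: crosses_def)
  then have e: "(p ! 0, p ! ?n) \<in> E" using assms(1) n by (auto simp: maximal_noncrossing_def)
  have inj: "p ! a = p ! b \<longleftrightarrow> a = b" if "a \<le> ?n" "b \<le> ?n" for a b
    using that n assms(3) by (simp add: nth_eq_iff_index_eq)
  have base: "k_built 2 E {p ! 0, p ! ?n}"
    using e assms(2) inj[of 0 ?n] n by (intro k_built_clique) (auto dest: symD)
  have "{p ! 0, p ! ?n} \<inter> (!) p ` {0<..<?n} = {}"
    using inj by (auto simp: disjoint_iff)
  then have "k_built 2 E ({p ! 0, p ! ?n} \<union> (!) p ` {0..?n})"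
    using k_built_interval[OF assms(1-3) n e base] by simp
  moreover have "{p ! 0, p ! ?n} \<union> (!) p ` {0..?n} = set p"
  proof -
    have "{0..?n} = {0..<length p}" using n by auto
    then have "(!) p ` {0..?n} = set p" by (metis list.set_map map_nth set_upt)
    moreover have "p ! 0 \<in> set p" "p ! ?n \<in> set p"
      using n by (intro nth_mem; linarith)+
    ultimately show ?thesis by blast
  qed
  ultimately show ?thesis by simp
qed

lemma noncrossing_maximal_outerplanar:
  assumes "maximal_outerplanar G" "distinct p" "set p = pverts G" "noncrossing (parcs G) p"
    and "sym (parcs G)" and arcs: "\<And>u v. (u, v) \<in> parcs G \<Longrightarrow> u \<in> pverts G \<and> v \<in> pverts G \<and> u \<noteq> v"
  shows "maximal_noncrossing (parcs G) p"
  unfolding maximal_noncrossing_def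
proof (intro conjI allI impI)
  fix i j assume ij: "i < j \<and> j < length p \<and> \<not> crosses (parcs G) p i j"
  let ?H = "add_edge (p ! i) (p ! j) G"
  have V: "p ! i \<in> pverts G" "p ! j \<in> pverts G" "p ! i \<noteq> p ! j"
    using ij assms(2,3) by (auto simp: nth_eq_iff_index_eq nth_mem simp flip: assms(3))
  have "outerplanar ?H"
  proof (rule noncrossing_imp_outerplanar)
    show "noncrossing (parcs ?H) p"
      using noncrossing_add_edge[OF assms(2,4)] ij by (simp add: add_edge_def)
    show "sym (parcs ?H)" using assms(5) by (auto simp: add_edge_def sym_def)
    show "u \<in> pverts ?H \<and> v \<in> pverts ?H \<and> u \<noteq> v" if "(u, v) \<in> parcs ?H" for u v
      using that arcs V by (auto simp: add_edge_def)
  qed (use assms in \<open>auto simp: add_edge_def\<close>)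
  then show "(p ! i, p ! j) \<in> parcs G"
    using assms(1) V unfolding maximal_outerplanar_def by blast
qed fact

context outerplane_graph
begin

lemma arcs_theta_free: "theta_free (parcs G)"
  unfolding theta_free_def using theta_inside(2) by blast

lemma arcs_crossing_chord_free: "crossing_chord_free (parcs G)"
  unfolding crossing_chord_free_def using no_crossing_chords by blast

end

lemma maximal_outerplanar_k_built:
  assumes G: "maximal_outerplanar G" and n: "2 \<le> card (pverts G)"
  shows "k_built 2 (parcs G) (pverts G)"
proof -
  have "outerplanar G" and pg: "pair_graph G" using G by (auto simp: maximal_outerplanar_def)
  then obtain \<phi> \<gamma> where "plane_embedding G \<phi> \<gamma>" "\<phi> ` pverts G \<subseteq> frontier (outside (drawing G \<phi> \<gamma>))"
    by (auto simp: outerplanar_def)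
  with pg interpret outerplane_graph G \<phi> \<gamma> by (rule outerplane_graph.intro)
  have fin: "finite (pverts G)" using n by (metis card.infinite not_numeral_le_zero)
  obtain p where p: "distinct p" "set p = pverts G" "noncrossing (parcs G) p"
    using noncrossing_order_exists[OF fin sym_arcs arcs_theta_free arcs_crossing_chord_free] by blast
  have "maximal_noncrossing (parcs G) p"
    using noncrossing_maximal_outerplanar[OF G p sym_arcs] arcs_in_verts by blast
  moreover have "2 \<le> length p" using n p(1,2) by (metis distinct_card)
  ultimately show ?thesis using maximal_noncrossing_k_built[OF _ sym_arcs p(1)] p(2) by simp
qed

section \<open>Distances\<close>

lemma pair_graph_finite: "pair_graph G \<Longrightarrow> finite (pverts G)"
  by (metis pair_graph_def pair_digraph_def pair_fin_digraph.pair_finite_verts)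

lemma pair_graphI:
  assumes "finite (pverts G)" "sym (parcs G)"
    and arcs: "\<And>u v. (u, v) \<in> parcs G \<Longrightarrow> u \<in> pverts G \<and> v \<in> pverts G \<and> u \<noteq> v"
  shows "pair_graph G"
proof -
  have e: "fst e \<in> pverts G" "snd e \<in> pverts G" "fst e \<noteq> snd e" if "e \<in> parcs G" for e
    using arcs[of "fst e" "snd e"] that by simp_all
  then have "parcs G \<subseteq> pverts G \<times> pverts G" by (auto simp: mem_Times_iff)
  then have "finite (parcs G)" using assms(1) by (simp add: finite_subset)
  moreover have "symmetric (with_proj G)" using assms(2) by (simp add: symmetric_def)
  ultimately show ?thesis using e assms(1) by unfold_locales
qed

text \<open>Turns walks given by arc lists into powers of the arc relation. The condition on
  \<open>u\<close> accounts for the empty walk, which exists only at vertices, whereas the zeroth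
  power is the identity on the whole type.\<close>

lemma awalk_iff_relpow:
  assumes "pair_graph G"
  shows "(\<exists>p. pre_digraph.awalk (with_proj G) u p v \<and> length p = m) \<longleftrightarrow>
    u \<in> pverts G \<and> (u, v) \<in> parcs G ^^ m"
proof -
  interpret pair_graph G by fact
  show ?thesis
  proof (induction m arbitrary: u)
    case 0
    then show ?case by (auto simp: awalk_Nil_iff)
  next
    case (Suc m)
    have "(\<exists>p. awalk u p v \<and> length p = Suc m) \<longleftrightarrow>
        (\<exists>x. (u, x) \<in> parcs G \<and> (\<exists>p. awalk x p v \<and> length p = m))"
    proof
      assume "\<exists>p. awalk u p v \<and> length p = Suc m"
      then obtain e p where "awalk u (e # p) v" "length p = m" by (auto simp: length_Suc_conv)
      then show "\<exists>x. (u, x) \<in> parcs G \<and> (\<exists>p. awalk x p v \<and> length p = m)"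
        by (intro exI[of _ "snd e"]) (auto simp: awalk_Cons_iff)
    next
      assume "\<exists>x. (u, x) \<in> parcs G \<and> (\<exists>p. awalk x p v \<and> length p = m)"
      then obtain x p where "(u, x) \<in> parcs G" "awalk x p v" "length p = m" by blast
      then show "\<exists>p. awalk u p v \<and> length p = Suc m"
        by (intro exI[of _ "(u, x) # p"]) (auto simp: awalk_Cons_iff)
    qed
    also have "\<dots> \<longleftrightarrow> u \<in> pverts G \<and> (u, v) \<in> parcs G ^^ Suc m"
    proof -
      have "(u, v) \<in> parcs G ^^ Suc m \<longleftrightarrow> (\<exists>x. (u, x) \<in> parcs G \<and> (x, v) \<in> parcs G ^^ m)"
        by (meson relpow_Suc_D2 relpow_Suc_I2)
      then show ?thesis unfolding Suc.IH using in_arcsD1 in_arcsD2 by blast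
    qed
    finally show ?case .
  qed
qed

text \<open>The distance enters the rest of the argument only through these thresholds.\<close>

lemma graph_dist_le_iff:
  assumes "pair_graph G"
  shows "graph_dist G u v \<le> enat d \<longleftrightarrow> u \<in> pverts G \<and> (\<exists>m\<le>d. (u, v) \<in> parcs G ^^ m)"
proof -
  let ?W = "{p. pre_digraph.awalk (with_proj G) u p v}"
  have "graph_dist G u v \<le> enat d \<longleftrightarrow> (\<exists>p\<in>?W. length p \<le> d)"
  proof
    assume le: "graph_dist G u v \<le> enat d"
    have "?W \<noteq> {}"
    proof
      assume "?W = {}"
      then have "graph_dist G u v = \<infinity>" by (simp add: graph_dist_def top_enat_def)
      then show False using le by simp
    qed
    \<comment> \<open>Extended naturals are well-ordered, so the infimum of a nonempty set is
      attained; an empty set of walks was excluded because its infimum is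
      \<open>\<infinity>\<close>.\<close>
    then have "graph_dist G u v \<in> (\<lambda>p. enat (length p)) ` ?W"
      unfolding graph_dist_def by (auto intro: wellorder_InfI)
    then show "\<exists>p\<in>?W. length p \<le> d" using le by auto
  next
    assume "\<exists>p\<in>?W. length p \<le> d"
    then obtain p where "p \<in> ?W" "length p \<le> d" by blast
    then show "graph_dist G u v \<le> enat d"
      unfolding graph_dist_def by (intro INF_lower2[of p]) auto
  qed
  also have "\<dots> \<longleftrightarrow> (\<exists>m\<le>d. \<exists>p. pre_digraph.awalk (with_proj G) u p v \<and> length p = m)" by blast
  finally show ?thesis unfolding awalk_iff_relpow[OF assms] by blast
qed

lemma relpow_sym:
  assumes "sym R" "(x, y) \<in> R ^^ m"
  shows "(y, x) \<in> R ^^ m"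
  using assms(2)
proof (induction m arbitrary: y)
  case (Suc m)
  then obtain z where "(x, z) \<in> R ^^ m" "(z, y) \<in> R" by auto
  then show ?case using Suc.IH assms(1) by (meson relpow_Suc_I2 symD)
qed auto

lemma relpow_in_verts:
  assumes "pair_graph G" "(u, v) \<in> parcs G ^^ m" "u \<in> pverts G"
  shows "v \<in> pverts G"
  using assms(2,3) pair_graph_arcs[OF assms(1)] by (induction m arbitrary: v) auto

lemma enat_eq_if_le_iff:
  assumes "\<And>d. x \<le> enat d \<longleftrightarrow> y \<le> enat d"
  shows "x = y"
proof (cases x)
  case (enat m)
  then have "y \<le> enat m" using assms[of m] by simp
  then obtain n where "y = enat n" by (cases y) auto
  then show ?thesis using assms[of m] assms[of n] enat by simp
next
  case infinity
  then show ?thesis using assms[of "the_enat y"] by (cases y) auto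
qed

lemma graph_dist_commute:
  assumes "pair_graph G"
  shows "graph_dist G u v = graph_dist G v u"
proof (rule enat_eq_if_le_iff)
  have "graph_dist G v u \<le> enat d" if "graph_dist G u v \<le> enat d" for u v d
    using that relpow_sym[OF pair_graph_sym[OF assms]] relpow_in_verts[OF assms]
    unfolding graph_dist_le_iff[OF assms] by blast
  then show "graph_dist G u v \<le> enat d \<longleftrightarrow> graph_dist G v u \<le> enat d" for d by blast
qed

lemma k_built_connected_graph:
  assumes "pair_graph G" "k_built k (parcs G) (pverts G)" "0 < k" "pverts G \<noteq> {}"
  shows "connected_graph G"
proof -
  interpret pair_graph G by fact
  have "u \<rightarrow>\<^sup>*\<^bsub>with_proj G\<^esub> v" if uv: "u \<in> pverts G" "v \<in> pverts G" for u v
  proof -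
    obtain m where "(u, v) \<in> parcs G ^^ m"
      using k_built_reachable[OF assms(2) pair_graph_sym[OF assms(1)] assms(3) uv] by blast
    then obtain p where "awalk u p v" using awalk_iff_relpow[OF assms(1)] uv by blast
    then show ?thesis by (rule reachable_awalkI)
  qed
  then have "Digraph_Component.connected (with_proj G)"
    using assms(4) reachable_mk_symmetric_eq[OF sym_arcs] by (intro connectedI) simp_all
  then show ?thesis using assms(1) by (simp add: connected_graph_def)
qed

section \<open>Pairs of vertices and the distance sequence\<close>

definition vertex_pairs :: "'a pair_pre_digraph \<Rightarrow> 'a set set" where
  "vertex_pairs G = {e. e \<subseteq> pverts G \<and> card e = 2}"

definition pair_dist :: "'a pair_pre_digraph \<Rightarrow> 'a set \<Rightarrow> nat" where
  "pair_dist G e = (THE d. \<exists>u v. e = {u, v} \<and> graph_dist G u v = enat d)"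

lemma finite_vertex_pairs: "finite (pverts G) \<Longrightarrow> finite (vertex_pairs G)"
  by (auto simp: vertex_pairs_def intro: finite_subset[of _ "Pow (pverts G)"])

lemma vertex_pairsE:
  assumes "e \<in> vertex_pairs G"
  obtains u v where "e = {u, v}" "u \<noteq> v" "u \<in> pverts G" "v \<in> pverts G"
  using assms by (auto simp: vertex_pairs_def card_2_iff)

lemma pair_dist:
  assumes "pair_graph G" "k_built k (parcs G) (pverts G)" "0 < k" "u \<in> pverts G" "v \<in> pverts G"
  shows "graph_dist G u v = enat (pair_dist G {u, v})"
proof -
  obtain m where "(u, v) \<in> parcs G ^^ m"
    using k_built_reachable[OF assms(2) pair_graph_sym[OF assms(1)] assms(3-)] by blast
  then have "graph_dist G u v \<le> enat m" using assms(4) graph_dist_le_iff[OF assms(1)] by blast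
  then obtain d where d: "graph_dist G u v = enat d" by (cases "graph_dist G u v") auto
  have "pair_dist G {u, v} = d"
    unfolding pair_dist_def
  proof (rule the_equality)
    show "\<exists>x y. {u, v} = {x, y} \<and> graph_dist G x y = enat d" using d by blast
    fix d' assume "\<exists>x y. {u, v} = {x, y} \<and> graph_dist G x y = enat d'"
    then show "d' = d" using d graph_dist_commute[OF assms(1), of u v] by (auto simp: doubleton_eq_iff)
  qed
  then show ?thesis using d by simp
qed

lemma pair_dist_pos:
  assumes "pair_graph G" "k_built k (parcs G) (pverts G)" "0 < k" "e \<in> vertex_pairs G"
  shows "0 < pair_dist G e"
proof (rule ccontr)
  assume "\<not> 0 < pair_dist G e"
  moreover obtain u v where uv: "e = {u, v}" "u \<noteq> v" "u \<in> pverts G" "v \<in> pverts G"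
    using assms(4) by (rule vertex_pairsE)
  ultimately have "graph_dist G u v \<le> enat 0" using pair_dist[OF assms(1-3) uv(3,4)] by simp
  then show False using uv(2) unfolding graph_dist_le_iff[OF assms(1)] by auto
qed

lemma distance_sequence_eq:
  "distance_sequence G = sorted_list_of_multiset (image_mset (pair_dist G) (mset_set (vertex_pairs G)))"
  by (simp add: distance_sequence_def pair_dist_def[abs_def] vertex_pairs_def)

lemma length_distance_sequence:
  assumes "finite (pverts G)"
  shows "length (distance_sequence G) = card (pverts G) choose 2"
proof -
  have "length (distance_sequence G) = size (mset (distance_sequence G))" by simp
  also have "\<dots> = card (vertex_pairs G)" by (simp add: distance_sequence_eq)
  finally show ?thesis using n_subsets[OF assms, of 2] by (simp add: vertex_pairs_def)
qed

lemma count_distance_sequence: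
  assumes "finite (pverts G)"
  shows "length (filter (\<lambda>x. x \<le> d) (distance_sequence G)) = card {e \<in> vertex_pairs G. pair_dist G e \<le> d}"
proof -
  have "length (filter (\<lambda>x. x \<le> d) (distance_sequence G)) =
      size (filter_mset (\<lambda>x. x \<le> d) (mset (distance_sequence G)))"
    by (simp flip: mset_filter)
  also have "\<dots> = size (filter_mset (\<lambda>e. pair_dist G e \<le> d) (mset_set (vertex_pairs G)))"
    by (simp add: distance_sequence_eq filter_mset_image_mset)
  also have "\<dots> = card {e \<in> vertex_pairs G. pair_dist G e \<le> d}"
    using finite_vertex_pairs[OF assms] by (simp add: filter_mset_mset_set)
  finally show ?thesis .
qed

text \<open>Compare the counts at the threshold \<open>ys ! i\<close>: at least \<open>i + 1\<close>
  entries of \<open>ys\<close> are below or equal to it, but at most \<open>i\<close> entries of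
  \<open>xs\<close> would be if \<open>xs ! i\<close> were larger.\<close>

lemma sorted_nth_le_if_counts_ge:
  fixes xs ys :: "nat list"
  assumes "sorted xs" "sorted ys" "length xs = length ys" "i < length xs"
    and count: "\<And>d. length (filter (\<lambda>x. x \<le> d) ys) \<le> length (filter (\<lambda>x. x \<le> d) xs)"
  shows "xs ! i \<le> ys ! i"
proof (rule ccontr)
  assume "\<not> xs ! i \<le> ys ! i"
  then have less: "ys ! i < xs ! i" by simp
  have "{j. j < length xs \<and> xs ! j \<le> ys ! i} \<subseteq> {..<i}"
  proof
    fix j assume j: "j \<in> {j. j < length xs \<and> xs ! j \<le> ys ! i}"
    have "\<not> i \<le> j"
    proof
      assume "i \<le> j"
      then have "xs ! i \<le> xs ! j" using j assms(1) by (simp add: sorted_nth_mono)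
      then show False using j less by simp
    qed
    then show "j \<in> {..<i}" by simp
  qed
  then have "length (filter (\<lambda>x. x \<le> ys ! i) xs) \<le> i"
    using card_mono[of "{..<i}"] by (simp add: length_filter_conv_card)
  moreover have "{..i} \<subseteq> {j. j < length ys \<and> ys ! j \<le> ys ! i}"
    using assms(2-4) by (auto simp: sorted_nth_mono)
  then have "Suc i \<le> length (filter (\<lambda>x. x \<le> ys ! i) ys)"
    using card_mono[of "{j. j < length ys \<and> ys ! j \<le> ys ! i}" "{..i}"]
    by (simp add: length_filter_conv_card)
  ultimately show False using count[of "ys ! i"] by simp
qed

text \<open>Coordinates are replaced one at a time from the left. The intermediate sequences need
  not be sorted, so the monotonicity of \<open>g\<close> on arbitrary sequences matters; they stay
  positive because entries only increase.\<close>

lemma coordinatewise_nondecreasing_mono: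
  assumes g: "coordinatewise_nondecreasing g" and pos: "\<forall>x\<in>set xs. 0 < x"
    and len: "length xs = length ys" and le: "\<And>i. i < length xs \<Longrightarrow> xs ! i \<le> ys ! i"
  shows "g xs \<le> g ys"
proof -
  have "g xs \<le> g (take m ys @ drop m xs)" if "m \<le> length xs" for m
    using that
  proof (induction m)
    case (Suc m)
    let ?zs = "take m ys @ drop m xs"
    have m: "m < length xs" using Suc.prems by simp
    have nth: "?zs ! i = (if i < m then ys ! i else xs ! i)" if "i < length xs" for i
      using that m len by (simp add: nth_append)
    have lenz: "length ?zs = length xs" using m len by simp
    have "0 < ?zs ! i" if "i < length xs" for i
      using nth[OF that] le[OF that] pos nth_mem[OF that] by (auto intro: less_le_trans)
    then have "\<forall>x\<in>set ?zs. 0 < x" using lenz by (metis in_set_conv_nth)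
    then have "g ?zs \<le> g (?zs[m := ys ! m])"
      using g m lenz nth[OF m] le[OF m] unfolding coordinatewise_nondecreasing_def by simp
    also have "?zs[m := ys ! m] = take (Suc m) ys @ drop (Suc m) xs"
    proof (rule nth_equalityI)
      fix i assume "i < length (?zs[m := ys ! m])"
      then have i: "i < length xs" using lenz by simp
      have "(?zs[m := ys ! m]) ! i = (if i = m then ys ! m else ?zs ! i)"
        using i lenz by (simp add: nth_list_update)
      also have "\<dots> = (if i < Suc m then ys ! i else xs ! i)" using nth[OF i] by auto
      also have "\<dots> = (take (Suc m) ys @ drop (Suc m) xs) ! i"
        using i m len by (simp add: nth_append)
      finally show "(?zs[m := ys ! m]) ! i = (take (Suc m) ys @ drop (Suc m) xs) ! i" .
    qed (use m len in simp)
    finally show ?case using Suc by simp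
  qed simp
  from this[of "length xs"] show ?thesis using len by simp
qed

section \<open>Counting close pairs in powers of the path and in built graphs\<close>

lemma path_power_pair_counts:
  assumes V: "pverts H = set p" "distinct p" and H: "pair_graph H" "k_built l (parcs H) (pverts H)" "0 < l"
    and short: "\<And>i j. i < length p \<Longrightarrow> j < length p \<Longrightarrow> (p ! i, p ! j) \<in> parcs H \<Longrightarrow> j \<le> i + k"
  shows "card {e \<in> vertex_pairs H. pair_dist H e \<le> d} \<le> (\<Sum>m<length p. min m (k * d))"
proof -
  \<comment> \<open>Each arc raises the index by at most \<open>k\<close>. The one-sided bound is
    enough because every pair is taken with \<open>i < j\<close> below.\<close>
  have walk: "j \<le> i + k * m" if "(p ! i, p ! j) \<in> parcs H ^^ m" "i < length p" "j < length p" for i j m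
    using that
  proof (induction m arbitrary: j)
    case 0
    then show ?case using V(2) by (simp add: nth_eq_iff_index_eq)
  next
    case (Suc m)
    then obtain x where x: "(p ! i, x) \<in> parcs H ^^ m" "(x, p ! j) \<in> parcs H" by auto
    then have "x \<in> set p" using pair_graph_arcs[OF H(1)] V(1) by blast
    then obtain a where a: "a < length p" "x = p ! a" by (metis in_set_conv_nth)
    then show ?case using Suc.IH[of a] Suc.prems x short[of a j] by auto
  qed
  \<comment> \<open>Pairs are counted by their larger index \<open>j\<close>. Subtraction is
    truncated at zero, which makes the cardinality \<open>min j (k * d)\<close>.\<close>
  let ?I = "\<lambda>j. {j - k * d..<j}"
  have "{e \<in> vertex_pairs H. pair_dist H e \<le> d} \<subseteq> (\<Union>j<length p. (\<lambda>i. {p ! i, p ! j}) ` ?I j)"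
  proof
    fix e assume "e \<in> {e \<in> vertex_pairs H. pair_dist H e \<le> d}"
    then have e: "e \<in> vertex_pairs H" "pair_dist H e \<le> d" by auto
    obtain u v where uv: "e = {u, v}" "u \<noteq> v" "u \<in> set p" "v \<in> set p"
      using e(1) V(1) by (metis vertex_pairsE)
    obtain a b where ab: "a < length p" "b < length p" "u = p ! a" "v = p ! b"
      using uv(3,4) by (metis in_set_conv_nth)
    have "\<exists>i j. i < j \<and> j < length p \<and> e = {p ! i, p ! j}"
    proof (cases "a < b")
      case False
      then have "b < a" using uv(2) ab by (metis linorder_neqE_nat)
      then show ?thesis using ab uv(1) by (intro exI[of _ b] exI[of _ a]) auto
    qed (use ab uv(1) in blast)
    then obtain i j where ij: "i < j" "j < length p" "e = {p ! i, p ! j}" by blast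
    have "p ! i \<in> pverts H" "p ! j \<in> pverts H" using ij V(1) by auto
    then have "graph_dist H (p ! i) (p ! j) \<le> enat d"
      using pair_dist[OF H] e(2) ij(3) by simp
    then obtain m where m: "m \<le> d" "(p ! i, p ! j) \<in> parcs H ^^ m"
      unfolding graph_dist_le_iff[OF H(1)] by blast
    have "j \<le> i + k * m" using walk[OF m(2)] ij by simp
    also have "\<dots> \<le> i + k * d" using m(1) by simp
    finally have "i \<in> ?I j" using ij(1) by auto
    then show "e \<in> (\<Union>j<length p. (\<lambda>i. {p ! i, p ! j}) ` ?I j)" using ij by blast
  qed
  then have "card {e \<in> vertex_pairs H. pair_dist H e \<le> d} \<le> card (\<Union>j<length p. (\<lambda>i. {p ! i, p ! j}) ` ?I j)"
    by (intro card_mono) auto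
  also have "\<dots> \<le> (\<Sum>j<length p. card ((\<lambda>i. {p ! i, p ! j}) ` ?I j))"
    by (intro card_UN_le) simp
  also have "\<dots> \<le> (\<Sum>j<length p. card (?I j))"
    by (intro sum_mono card_image_le) simp
  also have "\<dots> = (\<Sum>j<length p. min j (k * d))"
    by (intro sum.cong) auto
  finally show ?thesis .
qed

lemma k_built_pair_counts:
  assumes G: "pair_graph G" "k_built k (parcs G) (pverts G)" "0 < k"
  shows "(\<Sum>m<card (pverts G). min m (k * d)) \<le> card {e \<in> vertex_pairs G. pair_dist G e \<le> d}"
proof -
  have "close_pairs (parcs G) (pverts G) d \<subseteq> {e \<in> vertex_pairs G. pair_dist G e \<le> d}"
  proof
    fix e assume "e \<in> close_pairs (parcs G) (pverts G) d"
    then obtain u v where uv: "e = {u, v}" "u \<in> pverts G" "v \<in> pverts G" "u \<noteq> v"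
      "v \<in> ball_of (parcs G) (pverts G) d u" by (auto simp: close_pairs_def)
    have "graph_dist G u v \<le> enat d"
      using ball_of_relpow[OF uv(5)] uv(2) unfolding graph_dist_le_iff[OF G(1)] by blast
    then have "pair_dist G e \<le> d" using pair_dist[OF G uv(2,3)] uv(1) by simp
    moreover have "e \<in> vertex_pairs G" using uv by (auto simp: vertex_pairs_def)
    ultimately show "e \<in> {e \<in> vertex_pairs G. pair_dist G e \<le> d}" by simp
  qed
  then have "card (close_pairs (parcs G) (pverts G) d) \<le> card {e \<in> vertex_pairs G. pair_dist G e \<le> d}"
    using finite_vertex_pairs[OF pair_graph_finite[OF G(1)]] by (intro card_mono) auto
  then show ?thesis using card_close_pairs[OF G(2) pair_graph_sym[OF G(1)], of d] by linarith
qed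

lemma k_built_path:
  assumes "distinct p" "\<And>i. Suc i < length p \<Longrightarrow> (p ! i, p ! Suc i) \<in> E"
  shows "k_built 1 E (set p)"
  using assms
proof (induction p rule: rev_induct)
  case (snoc x p)
  have IH: "k_built 1 E (set p)"
  proof (rule snoc.IH)
    fix i assume "Suc i < length p"
    then show "(p ! i, p ! Suc i) \<in> E" using snoc.prems(2)[of i] by (simp add: nth_append)
  qed (use snoc.prems in simp)
  show ?case
  proof (cases "p = []")
    case True
    then show ?thesis using k_built_clique[of "{x}" E 1] by simp
  next
    case False
    then have "(last p, x) \<in> E"
      using snoc.prems(2)[of "length p - 1"] by (simp add: nth_append last_conv_nth)
    then have "k_built 1 E (insert x (set p))"
      using IH snoc.prems(1) False by (intro k_built.add[of 1 E "set p" x "{last p}"]) auto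
    then show ?thesis by simp
  qed
qed (simp add: k_built.empty)

text \<open>Two facts about the power are extracted: it is connected, in the form of
  \<open>k_built 1\<close>, and its arcs bridge at most \<open>k\<close> positions, because a step
  in the path changes the position by one.\<close>

lemma path_power:
  assumes "is_path_graph n P" "0 < k" "0 < n"
  defines "H \<equiv> graph_power P k"
  obtains p where "distinct p" "length p = n" "pverts H = set p" "pair_graph H" "k_built 1 (parcs H) (pverts H)"
    "\<And>i j. i < length p \<Longrightarrow> j < length p \<Longrightarrow> (p ! i, p ! j) \<in> parcs H \<Longrightarrow> j \<le> i + k"
proof -
  obtain p where p: "distinct p" "length p = n"
    "P = \<lparr>pverts = set p, parcs = {(p ! i, p ! j) |i j. i < n \<and> j < n \<and> (j = Suc i \<or> i = Suc j)}\<rparr>"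
    using assms(1) unfolding is_path_graph_def by blast
  have PV: "pverts P = set p" and
    PA: "parcs P = {(p ! i, p ! j) |i j. i < n \<and> j < n \<and> (j = Suc i \<or> i = Suc j)}"
    by (simp_all add: p(3))
  have P: "pair_graph P"
  proof (rule pair_graphI)
    show "finite (pverts P)" by (simp add: PV)
    show "sym (parcs P)" unfolding PA sym_def by blast
    show "u \<in> pverts P \<and> v \<in> pverts P \<and> u \<noteq> v" if "(u, v) \<in> parcs P" for u v
      using that p(1,2) by (auto simp: PA PV nth_eq_iff_index_eq)
  qed
  have H: "pverts H = set p"
    "parcs H = {(u, v). u \<in> set p \<and> v \<in> set p \<and> u \<noteq> v \<and> graph_dist P u v \<le> enat k}"
    by (simp_all add: H_def graph_power_def PV)
  have pgH: "pair_graph H"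
  proof (rule pair_graphI)
    show "sym (parcs H)"
      unfolding H sym_def using graph_dist_commute[OF P] by auto
  qed (auto simp: H)
  have kb: "k_built 1 (parcs H) (pverts H)"
    unfolding H(1)
  proof (rule k_built_path[OF p(1)])
    fix i assume i: "Suc i < length p"
    have "(p ! i, p ! Suc i) \<in> parcs P" using i p(2) unfolding PA by force
    then have "(p ! i, p ! Suc i) \<in> parcs P ^^ 1" by simp
    then have "graph_dist P (p ! i) (p ! Suc i) \<le> enat k"
      unfolding graph_dist_le_iff[OF P] PV using assms(2) i by (metis Suc_lessD Suc_leI One_nat_def nth_mem)
    then show "(p ! i, p ! Suc i) \<in> parcs H"
      using i p(1) by (auto simp: H nth_eq_iff_index_eq)
  qed
  have walk: "j \<le> i + m" if "(p ! i, p ! j) \<in> parcs P ^^ m" "i < length p" "j < length p" for i j m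
    using that
  proof (induction m arbitrary: j)
    case 0
    then show ?case using p(1) by (simp add: nth_eq_iff_index_eq)
  next
    case (Suc m)
    then obtain x where x: "(p ! i, x) \<in> parcs P ^^ m" "(x, p ! j) \<in> parcs P" by auto
    then obtain a b where ab: "x = p ! a" "p ! j = p ! b" "a < n" "b < n" "b = Suc a \<or> a = Suc b"
      unfolding PA by blast
    then have "b = j" using p(1,2) Suc.prems by (simp add: nth_eq_iff_index_eq)
    moreover have "a \<le> i + m" using Suc.IH[of a] Suc.prems(2) x(1) ab(1,3) p(2) by simp
    ultimately show ?case using ab(5) by linarith
  qed
  have short: "j \<le> i + k" if "i < length p" "j < length p" "(p ! i, p ! j) \<in> parcs H" for i j
  proof -
    have "graph_dist P (p ! i) (p ! j) \<le> enat k" using that(3) by (simp add: H(2))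
    then obtain m where m: "m \<le> k" "(p ! i, p ! j) \<in> parcs P ^^ m"
      unfolding graph_dist_le_iff[OF P] by blast
    have "j \<le> i + m" using walk[OF m(2) that(1,2)] .
    then show ?thesis using m(1) by simp
  qed
  show thesis using that[OF p(1,2) H(1) pgH kb short] .
qed

theorem k_built_extremal:
  assumes G: "pair_graph G" "k_built k (parcs G) (pverts G)" "0 < k"
    and n: "card (pverts G) = n" "0 < n" and P: "is_path_graph n P"
  shows "nondecreasing_distance_based I \<Longrightarrow> I G \<le> I (graph_power P k)"
    and "nonincreasing_distance_based I \<Longrightarrow> I G \<ge> I (graph_power P k)"
proof -
  let ?H = "graph_power P k"
  obtain p where p: "distinct p" "length p = n" "pverts ?H = set p"
    and H: "pair_graph ?H" "k_built 1 (parcs ?H) (pverts ?H)"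
    and short: "\<And>i j. i < length p \<Longrightarrow> j < length p \<Longrightarrow> (p ! i, p ! j) \<in> parcs ?H \<Longrightarrow> j \<le> i + k"
    using path_power[OF P G(3) n(2)] by blast
  have cH: "card (pverts ?H) = n" using p by (simp add: distinct_card)
  have fin: "finite (pverts G)" "finite (pverts ?H)" using pair_graph_finite G(1) H(1) by blast+
  have "pverts G \<noteq> {}" "pverts ?H \<noteq> {}" using n cH by (metis card.empty less_irrefl)+
  then have conn: "connected_graph G" "connected_graph ?H"
    using k_built_connected_graph[OF G] k_built_connected_graph[OF H] by auto
  let ?xs = "distance_sequence G" and ?ys = "distance_sequence ?H"
  have len: "length ?xs = length ?ys"
    using length_distance_sequence[OF fin(1)] length_distance_sequence[OF fin(2)] n(1) cH by simp
  have "length (filter (\<lambda>x. x \<le> d) ?ys) \<le> length (filter (\<lambda>x. x \<le> d) ?xs)" for d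
    unfolding count_distance_sequence[OF fin(1)] count_distance_sequence[OF fin(2)]
    \<comment> \<open>The sum of \<open>min m (k * d)\<close> over \<open>m < n\<close> bounds the
      count from above for the power of the path and from below for \<open>G\<close>.\<close>
    using path_power_pair_counts[OF p(3,1) H _ short, of d] k_built_pair_counts[OF G, of d] n(1) p(2)
    by simp
  moreover have "sorted ?xs" "sorted ?ys" by (simp_all add: distance_sequence_def)
  ultimately have le: "?xs ! i \<le> ?ys ! i" if "i < length ?xs" for i
    using sorted_nth_le_if_counts_ge[OF _ _ len that] by blast
  have pos: "\<forall>x\<in>set ?xs. 0 < x"
    using pair_dist_pos[OF G] finite_vertex_pairs[OF fin(1)] by (auto simp: distance_sequence_eq)
  have mono: "g ?xs \<le> g ?ys" if "coordinatewise_nondecreasing g" for g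
    using coordinatewise_nondecreasing_mono[OF that pos len le] .
  show "I G \<le> I ?H" if "nondecreasing_distance_based I"
    using that conn mono unfolding nondecreasing_distance_based_def distance_based_via_def by auto
  show "I G \<ge> I ?H" if I: "nonincreasing_distance_based I"
  proof -
    obtain g where g: "distance_based_via g I" "coordinatewise_nonincreasing g"
      using I unfolding nonincreasing_distance_based_def by blast
    \<comment> \<open>Negation reduces the nonincreasing case to the nondecreasing one.\<close>
    have "coordinatewise_nondecreasing (\<lambda>xs. - g xs)"
      using g(2) unfolding coordinatewise_nondecreasing_def coordinatewise_nonincreasing_def by simp
    from mono[OF this] show ?thesis using g(1) conn unfolding distance_based_via_def by simp
  qed
qed

text \<open>The second conjunct strengthens the induction: it makes the corners \<open>x\<close>,
  \<open>y\<close>, \<open>z\<close> of the face three distinct vertices, so the new vertex has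
  three earlier neighbours. As the arc set grows with every insertion, the hypothesis is carried
  over by \<open>k_built_mono\<close>.\<close>

lemma apollonian_plane_k_built:
  assumes "apollonian_plane G \<phi> \<gamma>"
  shows "k_built 3 (parcs G) (pverts G) \<and>
    (\<forall>(u, v)\<in>parcs G. u \<in> pverts G \<and> v \<in> pverts G \<and> u \<noteq> v)"
  using assms
proof (induction rule: apollonian_plane.induct)
  case (triangle a b c \<phi> \<gamma>)
  then show ?case
    by (auto simp: triangle_graph_def intro!: k_built_clique)
next
  case (insert G \<phi> \<gamma> F x y z w \<phi>' \<gamma>')
  have arcs: "(x, y) \<in> parcs G" "(y, z) \<in> parcs G" "(x, z) \<in> parcs G"
    using insert.hyps(2) by (auto simp: triangular_face_def)
  then have xyz: "{x, y, z} \<subseteq> pverts G" "x \<noteq> y" "y \<noteq> z" "x \<noteq> z" using insert.IH by auto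
  let ?H = "add_joined_vertex w {x, y, z} G"
  have "k_built 3 (parcs ?H) (pverts G)"
    using insert.IH by (auto simp: add_joined_vertex_def intro: k_built_mono)
  then have "k_built 3 (parcs ?H) (insert w (pverts G))"
    using insert.hyps(3) xyz by (intro k_built.add[of 3 _ _ w "{x, y, z}"]) (auto simp: add_joined_vertex_def)
  then have "k_built 3 (parcs ?H) (pverts ?H)" by (simp add: add_joined_vertex_def)
  moreover have "\<forall>(u, v)\<in>parcs ?H. u \<in> pverts ?H \<and> v \<in> pverts ?H \<and> u \<noteq> v"
    using insert.IH insert.hyps(3) xyz by (auto simp: add_joined_vertex_def)
  ultimately show ?case by (rule conjI)
qed

theorem corollary1:
  fixes G P :: "'a pair_pre_digraph"
    and I :: "'a pair_pre_digraph \<Rightarrow> real"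
    and n :: nat
  assumes "pair_graph G"
    and "card (pverts G) = n"
    and "n \<ge> 3"
    and "is_path_graph n P"
  shows "(maximal_outerplanar G \<longrightarrow>
           (nondecreasing_distance_based I \<longrightarrow> I G \<le> I (graph_power P 2)) \<and>
           (nonincreasing_distance_based I \<longrightarrow> I G \<ge> I (graph_power P 2))) \<and>
         (apollonian_network G \<longrightarrow>
           (nondecreasing_distance_based I \<longrightarrow> I G \<le> I (graph_power P 3)) \<and>
           (nonincreasing_distance_based I \<longrightarrow> I G \<ge> I (graph_power P 3)))"
proof -
  have n: "card (pverts G) = n" "0 < n" using assms(2,3) by simp_all
  have "k_built 2 (parcs G) (pverts G)" if "maximal_outerplanar G"
    using maximal_outerplanar_k_built[OF that] assms(2,3) by simp
  moreover have "k_built 3 (parcs G) (pverts G)" if "apollonian_network G"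
    using that apollonian_plane_k_built unfolding apollonian_network_def by blast
  ultimately show ?thesis
    using k_built_extremal[OF assms(1) _ _ n assms(4), of 2 I]
      k_built_extremal[OF assms(1) _ _ n assms(4), of 3 I] by simp
qed

end
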